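(* The $(n-1)$-dimensional volume of the cyclopermutohedron $\mathcal{CP}_{n+1}$ is zero: $$\mathrm{Vol}(\mathcal{CP}_{n+1})=0 .$$
   Context: Let $e_1,\dots,e_n$ be the standard basis of $\mathbb{R}^n$ and $e=(1,\dots,1)\in\mathbb{R}^n$. For $1\le i<j\le n$ let $q_{ij}=[e_i,e_j]$ be the segment with endpoints $e_i,e_j$ (defining vector $e_i-e_j$). For $1\le i\le n$ let $R_i=\sum_{j=1}^n(e_i-e_j)\in\mathbb{R}^n$, i.e. the vector with $i$-th coordinate $n-1$ and all other coordinates $-1$, and let $r_i=[0,R_i]$. Convex polytopes in $\mathbb{R}^n$ form a cancellative commutative semigroup under Minkowski addition; the elements of its Grothendieck group are called virtual polytopes (formal differences $K-L$). The cyclopermutohedron is the virtual polytope $$\mathcal{CP}_{n+1}=\bigoplus_{1\le i<j\le n}q_{ij}+e-\bigoplus_{i=1}^n r_i ,$$ where $\bigoplus$ is Minkowski sum and $-$ is the difference in the group of virtual polytopes. It lies in the hyperplane $x_1+\dots+x_n=n(n+1)/2$, so its dimension is $n-1$; all the segments $q_{ij}, r_i$ are parallel to the $(n-1)$-dimensional subspace $\{x:\ x_1+\dots+x_n=0\}$. Volume of a virtual zonotope: for real numbers $\lambda_{ij}\ge 0$, $\mu_k\ge0$, the $(n-1)$-dimensional Euclidean volume of the convex zonotope $\bigoplus_{i<j}\lambda_{ij}q_{ij}\oplus\bigoplus_k\mu_k r_k$ (which lies in a translate of that subspace) is a polynomial in the $\lambda_{ij},\mu_k$; the volume of the virtual zonotope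 with arbitrary real coefficients is defined as the value of this polynomial. Translations do not change the volume. Thus $\mathrm{Vol}(\mathcal{CP}_{n+1})$ is the value of this polynomial at $\lambda_{ij}=1$, $\mu_k=-1$.
   Formalization: The statement is proved for n ≥ 3; it fails for n = 2, where the volume is −√2 (since R_1 = −R_2 = e_1 − e_2), and for n = 1, where the volume is 1. *)

theory Defs
  imports "HOL-Analysis.Analysis"
begin

section \<open>Virtual polytopes\<close>

text \<open>
  On sets, \<open>+\<close> and \<open>\<Sum>\<close> denote the Minkowski sum (\<^theory>\<open>HOL-Library.Set_Algebras\<close>). The library counts
  the empty set as a polytope; it has to be excluded here because it absorbs every Minkowski sum.
\<close>

definition convex_polytope :: "'a::euclidean_space set \<Rightarrow> bool" where
  "convex_polytope K \<longleftrightarrow> polytope K \<and> K \<noteq> {}"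

lemma convex_polytope_plus:
  assumes "convex_polytope K" "convex_polytope L"
  shows "convex_polytope (K + L)"
proof -
  obtain A B where "finite A" "K = convex hull A" "finite B" "L = convex hull B"
    using assms unfolding convex_polytope_def polytope_def by auto
  then have "finite (A + B)" "K + L = convex hull (A + B)"
    by (auto simp: convex_hull_set_plus finite_set_plus)
  moreover have "K + L \<noteq> {}"
    using assms unfolding convex_polytope_def set_plus_def by auto
  ultimately show ?thesis
    unfolding convex_polytope_def polytope_def by auto
qed

lemma convex_polytope_singleton [simp]: "convex_polytope {a}"
  by (simp add: convex_polytope_def polytope_sing)

lemma convex_polytope_zero [simp]: "convex_polytope 0"
  by simp

text \<open>
  The Grothendieck group of convex polytopes: the pair \<open>(K, L)\<close> stands for the formal difference
  \<open>K - L\<close>. The usual auxiliary summand \<open>M\<close> may be dropped because the semigroup is cancellative.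
\<close>

definition virtual_polytope_rel ::
    "'a::euclidean_space set \<times> 'a set \<Rightarrow> 'a set \<times> 'a set \<Rightarrow> bool" where
  "virtual_polytope_rel X Y \<longleftrightarrow>
     convex_polytope (fst X) \<and> convex_polytope (snd X) \<and>
     convex_polytope (fst Y) \<and> convex_polytope (snd Y) \<and>
     (\<exists>M. convex_polytope M \<and> fst X + snd Y + M = fst Y + snd X + M)"

lemma virtual_polytope_relI:
  assumes "convex_polytope K" "convex_polytope L" "convex_polytope K'" "convex_polytope L'"
    and "convex_polytope M" "K + L' + M = K' + L + M"
  shows "virtual_polytope_rel (K, L) (K', L')"
  using assms unfolding virtual_polytope_rel_def by auto

lemma part_equivp_virtual_polytope_rel: "part_equivp virtual_polytope_rel"
proof (rule part_equivpI)
  show "\<exists>x::'a set \<times> 'a set. virtual_polytope_rel x x"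
    unfolding virtual_polytope_rel_def 
    by (intro exI[of _ "(0, 0)"]) (auto intro: exI[of _ 0])
  show "symp (virtual_polytope_rel :: 'a set \<times> 'a set \<Rightarrow> _)"
    unfolding virtual_polytope_rel_def symp_def by metis
  show "transp (virtual_polytope_rel :: 'a set \<times> 'a set \<Rightarrow> _)"
  proof (rule transpI)
    fix X Y Z :: "'a set \<times> 'a set"
    assume XY: "virtual_polytope_rel X Y" and YZ: "virtual_polytope_rel Y Z"
    obtain M where M: "convex_polytope M" "fst X + snd Y + M = fst Y + snd X + M"
      using XY unfolding virtual_polytope_rel_def by blast
    obtain N where N: "convex_polytope N" "fst Y + snd Z + N = fst Z + snd Y + N"
      using YZ unfolding virtual_polytope_rel_def by blast
    let ?P = "snd Y + M + N + fst Y"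
    have "fst X + snd Z + ?P = (fst X + snd Y + M) + (fst Y + snd Z + N)"
      by (simp add: ac_simps)
    also have "\<dots> = (fst Y + snd X + M) + (fst Z + snd Y + N)"
      by (simp only: M N)
    also have "\<dots> = fst Z + snd X + ?P"
      by (simp add: ac_simps)
    finally have "fst X + snd Z + ?P = fst Z + snd X + ?P" .
    moreover have "convex_polytope ?P"
      using M(1) N(1) XY unfolding virtual_polytope_rel_def
      by (intro convex_polytope_plus) auto
    ultimately show "virtual_polytope_rel X Z"
      using XY YZ unfolding virtual_polytope_rel_def by blast
  qed
qed

quotient_type (overloaded) 'a virtual_polytope =
    "('a::euclidean_space set \<times> 'a set)" / partial: virtual_polytope_rel
  by (rule part_equivp_virtual_polytope_rel)

instantiation virtual_polytope :: (euclidean_space) ab_group_add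
begin

lift_definition zero_virtual_polytope :: "'a virtual_polytope" is "(0, 0)"
  by (rule virtual_polytope_relI[where M = 0]) simp_all

lift_definition plus_virtual_polytope ::
    "'a virtual_polytope \<Rightarrow> 'a virtual_polytope \<Rightarrow> 'a virtual_polytope"
  is "\<lambda>X Y. (fst X + fst Y, snd X + snd Y)"
proof -
  fix X X' Y Y' :: "'a set \<times> 'a set"
  assume X: "virtual_polytope_rel X X'" and Y: "virtual_polytope_rel Y Y'"
  obtain M where M: "convex_polytope M" "fst X + snd X' + M = fst X' + snd X + M"
    using X unfolding virtual_polytope_rel_def by blast
  obtain N where N: "convex_polytope N" "fst Y + snd Y' + N = fst Y' + snd Y + N"
    using Y unfolding virtual_polytope_rel_def by blast
  have "(fst X + fst Y) + (snd X' + snd Y') + (M + N)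
      = (fst X + snd X' + M) + (fst Y + snd Y' + N)"
    by (simp add: ac_simps)
  also have "\<dots> = (fst X' + snd X + M) + (fst Y' + snd Y + N)"
    by (simp only: M N)
  also have "\<dots> = (fst X' + fst Y') + (snd X + snd Y) + (M + N)"
    by (simp add: ac_simps)
  finally show "virtual_polytope_rel (fst X + fst Y, snd X + snd Y)
      (fst X' + fst Y', snd X' + snd Y')"
    using X Y M(1) N(1)
    by (intro virtual_polytope_relI[where M = "M + N"] convex_polytope_plus)
      (auto simp: virtual_polytope_rel_def)
qed

lift_definition uminus_virtual_polytope :: "'a virtual_polytope \<Rightarrow> 'a virtual_polytope"
  is "\<lambda>X. (snd X, fst X)"
  unfolding virtual_polytope_rel_def by (metis add.commute fst_conv snd_conv)

definition minus_virtual_polytope ::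
    "'a virtual_polytope \<Rightarrow> 'a virtual_polytope \<Rightarrow> 'a virtual_polytope" where
  "X - Y = X + - (Y :: 'a virtual_polytope)"

instance
proof
  fix X Y Z :: "'a virtual_polytope"
  show "X + Y + Z = X + (Y + Z)"
    by transfer (auto simp: virtual_polytope_rel_def ac_simps
        intro!: convex_polytope_plus exI[of _ 0])
  show "X + Y = Y + X"
    by transfer (auto simp: virtual_polytope_rel_def ac_simps
        intro!: convex_polytope_plus exI[of _ 0])
  show "0 + X = X"
    by transfer (auto simp: virtual_polytope_rel_def simp del: set_zero)
  show "- X + X = 0"
    by transfer (auto simp: virtual_polytope_rel_def ac_simps simp del: set_zero
        intro!: convex_polytope_plus exI[of _ 0])
  show "X - Y = X + - Y"
    by (fact minus_virtual_polytope_def)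
qed

end

text \<open>The canonical map from convex polytopes; the value on other sets is irrelevant.\<close>

lift_definition of_polytope :: "'a::euclidean_space set \<Rightarrow> 'a virtual_polytope"
  is "\<lambda>K. if convex_polytope K then (K, 0) else (0, 0)"
  by (auto simp: virtual_polytope_rel_def simp del: set_zero intro!: exI[of _ 0])

definition multiple :: "real \<Rightarrow> 'a::euclidean_space set \<Rightarrow> 'a virtual_polytope" where
  "multiple c K =
     (if 0 \<le> c then of_polytope ((*\<^sub>R) c ` K) else - of_polytope ((*\<^sub>R) \<bar>c\<bar> ` K))"


section \<open>Volume inside a subspace\<close>

text \<open>
  Lebesgue measure of dimension \<^term>\<open>dim V\<close> on the subspace \<open>V\<close>, obtained from an orthonormal basis
  of \<open>V\<close> in the way \<^const>\<open>lborel\<close> is obtained from \<^const>\<open>Basis\<close>. It does not depend on the basis.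
\<close>

definition subspace_lborel :: "'a::euclidean_space set \<Rightarrow> 'a measure" where
  "subspace_lborel V =
     (let B = (SOME B. pairwise orthogonal B \<and> (\<forall>b\<in>B. norm b = 1) \<and> span B = V)
      in distr (\<Pi>\<^sub>M b\<in>B. lborel) borel (\<lambda>f. \<Sum>b\<in>B. f b *\<^sub>R b))"

text \<open>
  Volume of a nonempty set contained in some translate of the subspace \<open>V\<close>: a point of the set is
  moved to the origin. The choice of that point is immaterial.
\<close>

definition volume_along :: "'a::euclidean_space set \<Rightarrow> 'a set \<Rightarrow> real" where
  "volume_along V K = measure (subspace_lborel V) ((\<lambda>x. x - (SOME p. p \<in> K)) ` K)"


section \<open>The cyclopermutohedron\<close>

text \<open>
  The index type \<open>'n\<close> plays the role of \<open>{1, \<dots>, n}\<close>. (A finite linear order is a well-order.)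
\<close>

definition q :: "'n::{finite,wellorder} \<Rightarrow> 'n \<Rightarrow> (real^'n::_) set" where
  "q i j = closed_segment (axis i 1) (axis j 1)"

definition R :: "'n::{finite,wellorder} \<Rightarrow> real^'n::_" where
  "R i = (\<Sum>j\<in>UNIV. axis i 1 - axis j 1)"

definition r :: "'n::{finite,wellorder} \<Rightarrow> (real^'n::_) set" where
  "r i = closed_segment 0 (R i)"

definition cyclopermutohedron :: "(real^'n::{finite,wellorder}) virtual_polytope" where
  "cyclopermutohedron =
     (\<Sum>(i, j)\<in>{(i, j). i < j}. of_polytope (q i j)) + of_polytope {\<Sum>i\<in>UNIV. axis i 1}
     - (\<Sum>i\<in>UNIV. of_polytope (r i))"


section \<open>Volume of virtual zonotopes\<close>

text \<open>
  Coefficients are given as a pair \<open>(\<lambda>, \<mu>)\<close> of a matrix and a vector, so that they form a normed space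
  on which \<^const>\<open>real_polynomial_function\<close> makes sense; only the entries of \<open>\<lambda>\<close> strictly above the
  diagonal are used.
\<close>

type_synonym 'n coeffs = "(real^'n^'n) \<times> (real^'n)"

definition nonneg_coeffs :: "'n::{finite,wellorder} coeffs \<Rightarrow> bool" where
  "nonneg_coeffs c \<longleftrightarrow> (\<forall>i j. i < j \<longrightarrow> 0 \<le> fst c $ i $ j) \<and> (\<forall>k. 0 \<le> snd c $ k)"

definition zonotope :: "'n::{finite,wellorder} coeffs \<Rightarrow> (real^'n::_) set" where
  "zonotope c =
     (\<Sum>(i, j)\<in>{(i, j). i < j}. (*\<^sub>R) (fst c $ i $ j) ` q i j)
     + (\<Sum>k\<in>UNIV. (*\<^sub>R) (snd c $ k) ` r k)"

definition virtual_zonotope :: "'n::{finite,wellorder} coeffs \<Rightarrow> (real^'n::_) virtual_polytope" where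
  "virtual_zonotope c =
     (\<Sum>(i, j)\<in>{(i, j). i < j}. multiple (fst c $ i $ j) (q i j))
     + (\<Sum>k\<in>UNIV. multiple (snd c $ k) (r k))"

definition sum_zero_hyperplane :: "(real^'n) set" where
  "sum_zero_hyperplane = {x. (\<Sum>i\<in>UNIV. x $ i) = 0}"

definition volume_polynomial :: "'n::{finite,wellorder} coeffs \<Rightarrow> real" where
  "volume_polynomial =
     (THE P. real_polynomial_function P \<and>
        (\<forall>c. nonneg_coeffs c \<longrightarrow> P c = volume_along sum_zero_hyperplane (zonotope c)))"

text \<open>
  The volume of a translate of a virtual zonotope. The value of the polynomial is the same for all
  representations of \<open>X\<close>, so the description is proper whenever \<open>X\<close> has a representation.
\<close>

definition virtual_volume :: "(real^'n::{finite,wellorder}) virtual_polytope \<Rightarrow> real" where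
  "virtual_volume X =
     (THE v. \<exists>c t. X = virtual_zonotope c + of_polytope {t} \<and> v = volume_polynomial c)"

end

theory Submission
  imports Defs
begin

text \<open>
  Let \<open>e = (1, \<dots>, 1)\<close> and let \<open>u\<close> be the unit vector in its direction. Adding the segment \<open>[0, u]\<close> to
  a set parallel to the hyperplane \<open>x\<^sub>1 + \<dots> + x\<^sub>n = 0\<close> turns its \<open>(n-1)\<close>-dimensional volume into an
  \<open>n\<close>-dimensional one, and once \<open>e\<close> is among the generators, the vector \<open>R\<^sub>k = n e\<^sub>k - e\<close> is as good as
  \<open>n e\<^sub>k\<close>. So the volume in question is governed by determinants whose rows are of the form
  \<open>e\<^sub>i - e\<^sub>j\<close> or \<open>e\<^sub>k\<close>, with one further row \<open>e\<close>.

  Such determinants can be summed. The volume of \<open>[0, c\<^sub>1 w\<^sub>1] + \<dots> + [0, c\<^sub>m w\<^sub>m]\<close> is affine in each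
  length \<open>c\<^sub>k \<ge> 0\<close> (\<open>volume_zonotope_affine\<close>) and homogeneous of degree \<open>n\<close>; a function
  with these two properties is determined by its values on indicators of \<open>n\<close>-element sets
  (\<open>multiaffine_homogeneous_eq_0\<close>), where the volume is \<open>\<bar>det\<bar>\<close>. The determinant of
  \<open>c\<^sub>1 z\<^sub>1 z\<^sub>1\<^sup>T + \<dots> + c\<^sub>m z\<^sub>m z\<^sub>m\<^sup>T\<close> is of the same kind, with values \<open>det\<^sup>2\<close>. For vectors
  \<open>e\<^sub>i - e\<^sub>j\<close> and \<open>e\<^sub>k\<close> all determinants are \<open>0\<close> or \<open>\<plusminus>1\<close>, so that \<open>\<bar>det\<bar> = det\<^sup>2\<close>; moreover the
  cofactors along the row \<open>e\<close> never have opposite signs, so that expanding it produces no cancellation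
  (\<open>abs_cofactor_sum\<close>). The outcome is (\<open>volume_eq_sum_minors\<close>)
  \[ \mathrm{Vol}(\lambda, \mu) = \sum_v \bigl(\det(L + s E_{vv}) - \det L\bigr), \qquad
     L = \sum_{i<j} \lambda_{ij} (e_i - e_j)(e_i - e_j)^T + n\,\mathrm{diag}(\mu), \qquad s = 1/\sqrt n, \]
  which is visibly a polynomial. At \<open>\<lambda> = 1\<close>, \<open>\<mu> = -1\<close> the graph Laplacian of the complete graph,
  \<open>n I - J\<close> with \<open>J\<close> the all-ones matrix, is diminished by \<open>n I\<close>, so \<open>L = - J\<close>. Altering one diagonal
  entry of \<open>- J\<close> leaves two equal rows as soon as \<open>n \<ge> 3\<close>, and every summand vanishes.

  That the volume of a virtual zonotope is well defined rests on one device: adding a large multiple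
  of the all-ones coefficients makes all coefficients nonnegative, virtual polytopes that are equal
  there come from equal convex ones by the cancellation law, and two polynomials that agree far out
  on a ray agree on the whole line.
\<close>

section \<open>Determinants of graphic matrices\<close>

definition outer :: "real^'n \<Rightarrow> real^'n^'n" where
  "outer z = (\<chi> i j. z $ i * z $ j)"

lemma det_add_row_multiples:
  fixes A :: "real^'n^'n"
  assumes "p \<notin> J"
  shows "det (\<chi> i. if i \<in> J then A $ i + c i *s A $ p else A $ i) = det A"
proof -
  have "finite J" by simp
  then show ?thesis using assms
  proof (induction J)
    case empty
    then show ?case by simp
  next
    case (insert j J)
    define B where "B = (\<chi> i. if i \<in> J then A $ i + c i *s A $ p else A $ i)"
    have "(\<chi> i. if i \<in> insert j J then A $ i + c i *s A $ p else A $ i) =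
        (\<chi> k. if k = j then row j B + c j *s row p B else row k B)"
      using insert by (auto simp: vec_eq_iff B_def row_def)
    also have "det \<dots> = det B"
      using insert by (intro det_row_operation) auto
    also have "\<dots> = det A" using insert B_def by auto
    finally show ?case .
  qed
qed

text \<open>
  Since \<open>outer z\<close> has rank one, row operations with a pivot \<open>z\<^sub>p \<noteq> 0\<close> confine the parameter \<open>t\<close> to
  row \<open>p\<close>, in which the determinant is linear.
\<close>

lemma det_add_outer:
  fixes M :: "real^'n^'n"
  shows "det (M + t *\<^sub>R outer z) = det M + t * (det (M + outer z) - det M)"
proof (cases "z = 0")
  case True
  then have "outer z = 0" by (simp add: outer_def vec_eq_iff)
  then show ?thesis by simp
next
  case False
  then obtain p where p: "z $ p \<noteq> 0" by (auto simp: vec_eq_iff)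
  \<comment> \<open>chosen so that adding \<open>c i\<close> times row \<open>p\<close> cancels \<open>t\<close> in row \<open>i\<close>\<close>
  define c where "c i = - (z $ i / z $ p)" for i
  define \<alpha> where "\<alpha> = det (\<chi> i. if i = p then M $ p else M $ i + c i *s M $ p)"
  define \<beta> where "\<beta> = det (\<chi> i. if i = p then z $ p *s z else M $ i + c i *s M $ p)"
  have *: "det (M + t *\<^sub>R outer z) = \<alpha> + t * \<beta>" for t
  proof -
    define N where "N = M + t *\<^sub>R outer z"
    have N: "N $ i = M $ i + (t * z $ i) *s z" for i
      by (auto simp: N_def outer_def vec_eq_iff)
    have "det N = det (\<chi> i. if i \<in> - {p} then N $ i + c i *s N $ p else N $ i)"
      by (rule det_add_row_multiples [symmetric]) auto
    also have "(\<chi> i. if i \<in> - {p} then N $ i + c i *s N $ p else N $ i) =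
       (\<chi> i. if i = p then M $ p + t *s (z $ p *s z) else M $ i + c i *s M $ p)"
      using p by (auto simp: vec_eq_iff N c_def field_simps)
    also have "det \<dots> = \<alpha> + t * \<beta>"
      unfolding det_row_add[of p "\<lambda>_. M $ p" "\<lambda>_. t *s (z $ p *s z)"]
        det_row_mul[of p t "\<lambda>_. z $ p *s z"] \<alpha>_def \<beta>_def ..
    finally show ?thesis by (simp add: N_def)
  qed
  from *[of 0] *[of 1] *[of t] show ?thesis by simp
qed

text \<open>
  The sum is \<open>Y\<^sup>T D Y\<close>, where \<open>Y\<close> has the rows \<open>y i\<close> and \<open>D\<close> is diagonal.
\<close>

lemma det_sum_outer:
  fixes y :: "'n::finite \<Rightarrow> real^'n"
  shows "det (\<Sum>i\<in>UNIV. \<delta> i *\<^sub>R outer (y i)) = (\<Prod>i\<in>UNIV. \<delta> i) * (det (\<chi> i. y i))\<^sup>2"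
proof -
  have "(\<Sum>i\<in>UNIV. \<delta> i *\<^sub>R outer (y i)) = transpose (\<chi> i. y i) ** (\<chi> i. \<delta> i *s y i)"
    by (auto simp: vec_eq_iff outer_def matrix_matrix_mult_def transpose_def algebra_simps)
  then show ?thesis
    by (simp add: det_mul det_rows_mul power2_eq_square)
qed

text \<open>
  Rows of the incidence matrix of an oriented graph, after the column of a root has been deleted: an
  edge to the root becomes \<open>e\<^sub>i\<close>. The zero vector is covered by \<open>i = j\<close> (a loop).
\<close>

definition graphic :: "real^'n \<Rightarrow> bool" where
  "graphic z \<longleftrightarrow> (\<exists>i. z = axis i 1) \<or> (\<exists>i j. z = axis i 1 - axis j 1)"

lemma det_Ints:
  fixes A :: "real^'n^'n"
  assumes "\<And>i j. A $ i $ j \<in> \<int>"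
  shows "det A \<in> \<int>"
  unfolding det_def using assms by (intro Ints_sum Ints_mult Ints_prod) auto

text \<open>
  Total unimodularity of incidence matrices. The inverse of \<open>Y\<close> is integral: if \<open>Y x\<close> is integral, then
  every row says that some \<open>x\<^sub>i\<close> or some \<open>x\<^sub>i - x\<^sub>j\<close> is an integer, so the fractional parts of \<open>x\<close>
  form a vector in the kernel of \<open>Y\<close>, which is trivial. Hence \<open>det Y\<close> is an integer with integer
  inverse.
\<close>

lemma det_graphic:
  fixes Y :: "real^'n^'n"
  assumes Y: "\<And>i. graphic (Y $ i)"
  shows "det Y \<in> {-1, 0, 1}"
proof (cases "det Y = 0")
  case False
  then have inv: "invertible Y" by (simp add: invertible_det_nz)
  then obtain X where YX: "Y ** X = mat 1" and XY: "X ** Y = mat 1"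
    by (auto simp: invertible_def)
  have "X $ j $ k \<in> \<int>" for j k
  proof -
    define x where "x = column k X"
    have "Y *v x = column k (Y ** X)"
      by (simp add: x_def vec_eq_iff column_def matrix_vector_mult_def matrix_matrix_mult_def)
    then have Yx: "(Y *v x) $ i \<in> \<int>" for i
      by (simp add: YX column_def mat_def)
    define h where "h = (\<chi> i. frac (x $ i))"
    have "(Y *v h) $ i = 0" for i
    proof -
      have Yxi: "Y $ i \<bullet> x \<in> \<int>" using Yx[of i] by (simp add: matrix_mult_dot)
      consider a where "Y $ i = axis a 1" | a b where "Y $ i = axis a 1 - axis b 1"
        using Y[of i] by (auto simp: graphic_def)
      then have "Y $ i \<bullet> h = 0"
      proof cases
        case 1
        then have "x $ a \<in> \<int>" using Yxi by (simp add: inner_axis')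
        then show ?thesis using 1 by (simp add: inner_axis' h_def frac_eq_0_iff)
      next
        case 2
        then have "x $ a - x $ b \<in> \<int>" using Yxi by (simp add: inner_axis' inner_diff_left)
        then have "frac (x $ a) = frac (x $ b)"
          by (auto elim!: Ints_cases simp: frac_def algebra_simps)
        then show ?thesis using 2 by (simp add: inner_axis' inner_diff_left h_def)
      qed
      then show ?thesis by (simp add: matrix_mult_dot)
    qed
    then have "Y *v h = 0" by (simp add: vec_eq_iff)
    then have "X *v (Y *v h) = 0" by simp
    then have "h = 0" by (simp add: matrix_vector_mul_assoc XY)
    then have "frac (x $ j) = 0" by (simp add: h_def vec_eq_iff)
    then show ?thesis by (simp add: frac_eq_0_iff x_def column_def)
  qed
  then have "det X \<in> \<int>" by (rule det_Ints)
  moreover have "det Y \<in> \<int>"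
  proof (rule det_Ints)
    show "Y $ i $ j \<in> \<int>" for i j
      using Y[of i] by (auto simp: graphic_def axis_def)
  qed
  moreover have "det Y * det X = 1" by (metis YX det_I det_mul)
  ultimately obtain m n :: int where "det Y = of_int m" "det X = of_int n" "m * n = 1"
    by (metis Ints_cases of_int_eq_1_iff of_int_mult)
  then show ?thesis by (auto simp: zmult_eq_1_iff)
qed simp

text \<open>
  The vector \<open>u\<close> of cofactors of row \<open>p\<close>, unless zero, spans the orthogonal complement of the other rows.
  Orthogonality to \<open>e\<^sub>i - e\<^sub>j\<close> or \<open>e\<^sub>i\<close> means \<open>u\<^sub>i = u\<^sub>j\<close> or \<open>u\<^sub>i = 0\<close>, which is inherited by the
  indicator of any level set \<open>{u = \<alpha>}\<close> with \<open>\<alpha> \<noteq> 0\<close>. Therefore \<open>u\<close> is a multiple of an indicator,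
  by \<open>\<plusminus>1\<close>. (In terms of graphs: the indicator of the one tree of a forest that misses the root.)
\<close>

lemma abs_cofactor_sum:
  fixes y :: "'n::finite \<Rightarrow> real^'n"
  assumes y: "\<And>i. i \<noteq> p \<Longrightarrow> graphic (y i)"
  defines "D \<equiv> \<lambda>z. det (\<chi> i. if i = p then z else y i)"
  shows "\<bar>D 1\<bar> = (\<Sum>v\<in>UNIV. (D (axis v 1))\<^sup>2)"
proof -
  define u where "u = (\<chi> v. D (axis v 1))"
  have D: "D z = u \<bullet> z" for z
  proof -
    have "D z = D (\<Sum>v\<in>UNIV. z $ v *s axis v 1)" by (simp add: basis_expansion)
    also have "\<dots> = (\<Sum>v\<in>UNIV. D (z $ v *s axis v 1))"
      unfolding D_def by (rule det_linear_row_sum) simp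
    also have "\<dots> = (\<Sum>v\<in>UNIV. z $ v * D (axis v 1))"
      unfolding D_def
      by (intro sum.cong refl det_row_mul[where a = "\<lambda>_. axis _ 1"])
    finally show ?thesis by (simp add: u_def inner_vec_def mult.commute)
  qed
  have orth: "u \<bullet> y i = 0" if "i \<noteq> p" for i
  proof -
    have "D (y i) = 0" unfolding D_def
      by (rule det_identical_rows[of i p]) (use that in \<open>auto simp: row_def\<close>)
    then show ?thesis by (simp add: D)
  qed
  show ?thesis
  proof (cases "u = 0")
    case True
    then show ?thesis by (simp add: D)
  next
    case False
    then obtain a where a: "u $ a \<noteq> 0" by (auto simp: vec_eq_iff)
    define \<alpha> where "\<alpha> = u $ a"
    define f where "f = (\<chi> v. if u $ v = \<alpha> then 1 else (0::real))"
    define Y where "Y = (\<chi> i. if i = p then axis a 1 else y i)"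
    \<comment> \<open>\<open>Y\<close> is graphic, which bounds \<open>\<alpha>\<close>, and invertible, which identifies \<open>u\<close> with \<open>\<alpha> f\<close>\<close>
    have detY: "det Y = \<alpha>" by (simp add: Y_def \<alpha>_def u_def D_def)
    have "graphic (Y $ i)" for i
      using y by (auto simp: Y_def graphic_def)
    then have \<alpha>1: "\<alpha> \<in> {-1, 1}" using det_graphic[of Y] detY a \<alpha>_def by auto
    have "f \<bullet> y i = 0" if i: "i \<noteq> p" for i
    proof -
      consider j where "y i = axis j 1" | j k where "y i = axis j 1 - axis k 1"
        using y[OF i] by (auto simp: graphic_def)
      then show ?thesis
        using orth[OF i] a by cases (auto simp: inner_axis inner_diff_right f_def \<alpha>_def)
    qed
    with orth have "Y *v (u - \<alpha> *\<^sub>R f) = 0"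
      by (auto simp: vec_eq_iff matrix_mult_dot Y_def inner_axis inner_axis' f_def \<alpha>_def inner_diff_right
          inner_commute)
    then have "u - \<alpha> *\<^sub>R f = 0"
      using a detY \<alpha>_def by (metis invertible_det_nz matrix_left_invertible_ker invertible_left_inverse)
    then have u: "u $ v = \<alpha> * f $ v" for v by (simp add: vec_eq_iff)
    have "D 1 = \<alpha> * (\<Sum>v\<in>UNIV. f $ v)"
      by (simp add: D inner_vec_def u sum_distrib_left)
    moreover have "0 \<le> (\<Sum>v\<in>UNIV. f $ v)" by (intro sum_nonneg) (simp add: f_def)
    ultimately have "\<bar>D 1\<bar> = (\<Sum>v\<in>UNIV. f $ v)" using \<alpha>1 by (auto simp: abs_mult)
    also have "\<dots> = (\<Sum>v\<in>UNIV. (u $ v)\<^sup>2)"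
    proof (rule sum.cong [OF refl])
      fix v
      have "f $ v \<in> {0, 1}" by (simp add: f_def)
      then show "f $ v = (u $ v)\<^sup>2" using \<alpha>1 u[of v] by auto
    qed
    finally show ?thesis by (simp add: u_def)
  qed
qed

text \<open>
  The comparison of volume and determinant on a basis that contains the all-ones vector, as row \<open>p\<close>.
  Adding multiples of that row removes the terms \<open>\<epsilon> i\<close>, and the weights \<open>\<delta> i\<close> factor out of both sides.
\<close>

lemma abs_det_eq_sum_det_outer:
  fixes y :: "'n::finite \<Rightarrow> real^'n"
  assumes y: "\<And>i. i \<noteq> p \<Longrightarrow> graphic (y i)" and \<delta>: "\<And>i. i \<noteq> p \<Longrightarrow> 0 \<le> \<delta> i"
  defines "L \<equiv> \<Sum>i\<in>UNIV - {p}. \<delta> i *\<^sub>R outer (y i)"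
  shows "\<bar>det (\<chi> i. if i = p then 1 else \<delta> i *s y i - \<epsilon> i *s 1)\<bar> =
    (\<Sum>v\<in>UNIV. det (L + outer (axis v 1)) - det L)"
proof -
  define D where "D z = det (\<chi> i. if i = p then z else y i)" for z
  define \<delta>' where "\<delta>' s i = (if i = p then s else \<delta> i)" for s i
  have prod: "(\<Prod>i\<in>UNIV. \<delta>' s i) = s * (\<Prod>i\<in>UNIV-{p}. \<delta> i)" for s
    by (subst prod.remove[of _ p]) (auto simp: \<delta>'_def)
  have L: "det (L + s *\<^sub>R outer z) = s * (\<Prod>i\<in>UNIV-{p}. \<delta> i) * (D z)\<^sup>2" for s z
  proof -
    have "L + s *\<^sub>R outer z =
        (\<Sum>i\<in>UNIV. \<delta>' s i *\<^sub>R outer (if i = p then z else y i))"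
      by (simp add: sum.remove[of UNIV p] L_def \<delta>'_def add.commute)
    then show ?thesis by (simp only: det_sum_outer prod D_def)
  qed
  define A where "A = (\<chi> i. if i = p then 1 else \<delta> i *s y i)"
  have "(\<chi> i. if i = p then 1 else \<delta> i *s y i - \<epsilon> i *s 1) =
      (\<chi> i. if i \<in> - {p} then A $ i + (- \<epsilon> i) *s A $ p else A $ i)"
    by (auto simp: A_def vec_eq_iff)
  then have "det (\<chi> i. if i = p then 1 else \<delta> i *s y i - \<epsilon> i *s 1) = det A"
    using det_add_row_multiples[of p "- {p}" A "\<lambda>i. - \<epsilon> i"] by simp
  also have "A = (\<chi> i. \<delta>' 1 i *s (if i = p then 1 else y i))"
    by (auto simp: A_def \<delta>'_def vec_eq_iff)
  also have "det \<dots> = (\<Prod>i\<in>UNIV-{p}. \<delta> i) * D 1"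
    by (simp add: det_rows_mul prod D_def)
  finally have "\<bar>det (\<chi> i. if i = p then 1 else \<delta> i *s y i - \<epsilon> i *s 1)\<bar> =
      (\<Prod>i\<in>UNIV-{p}. \<delta> i) * \<bar>D 1\<bar>"
    using prod_nonneg[of "UNIV - {p}" \<delta>] \<delta> by (simp add: abs_mult)
  also have "\<dots> = (\<Sum>v\<in>UNIV. (\<Prod>i\<in>UNIV-{p}. \<delta> i) * (D (axis v 1))\<^sup>2)"
    unfolding D_def by (subst abs_cofactor_sum) (use y in \<open>auto simp: sum_distrib_left\<close>)
  also have "\<dots> = (\<Sum>v\<in>UNIV. det (L + outer (axis v 1)) - det L)"
    using L[of 1] L[of 0] by simp
  finally show ?thesis .
qed

section \<open>Multi-affine homogeneous functions\<close>

text \<open>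
  By induction on the support \<open>T\<close> of \<open>c\<close>: if \<open>h\<close> vanishes on all smaller supports, it is linear in every
  coordinate of \<open>T\<close>, so \<open>h c = (\<Prod>k\<in>T. c k) * h (indicator T)\<close> has degree \<open>card T\<close>, which contradicts
  homogeneity unless \<open>card T = d\<close> or \<open>h (indicator T) = 0\<close>. The scaling factor 2 suffices to tell degrees
  apart.
\<close>

lemma multiaffine_homogeneous_eq_0:
  fixes h :: "('k::finite \<Rightarrow> real) \<Rightarrow> real"
  assumes affine: "\<And>c k t. (\<And>i. 0 \<le> c i) \<Longrightarrow> 0 \<le> t \<Longrightarrow>
      h (c(k := t)) = h (c(k := 0)) + t * (h (c(k := 1)) - h (c(k := 0)))"
    and homogeneous: "\<And>c. (\<And>i. 0 \<le> c i) \<Longrightarrow> h (\<lambda>i. 2 * c i) = 2 ^ d * h c"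
    and indicator: "\<And>S. card S = d \<Longrightarrow> h (indicator S) = 0"
    and c: "\<And>i. 0 \<le> c i"
  shows "h c = 0"
proof -
  have "h c = 0" if "\<And>i. 0 \<le> c i" "\<And>i. i \<notin> T \<Longrightarrow> c i = 0" for c and T :: "'k set"
    using that
  proof (induction "card T" arbitrary: T c rule: less_induct)
    case less
    have zero: "h b = 0" if "\<And>i. 0 \<le> b i" "\<And>i. i \<notin> T \<Longrightarrow> b i = 0" "k \<in> T" "b k = 0" for b k
      using that by (intro less.hyps[of "T - {k}"])
        (auto intro: card_Diff1_less simp del: card_Diff_insert card_Diff_singleton)
    have expand: "h (\<lambda>i. if i \<in> U then c i else indicator T i) = (\<Prod>i\<in>U. c i) * h (indicator T)"
      if "U \<subseteq> T" "\<And>i. 0 \<le> c i" for U and c :: "'k \<Rightarrow> real"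
    proof -
      have "finite U" by simp
      then show ?thesis using that(1)
      proof (induction U)
        case empty
        then show ?case by (simp cong: if_cong)
      next
        case (insert k U)
        define b where "b = (\<lambda>i. if i \<in> U then c i else indicator T i)"
        have b: "0 \<le> b i" for i using that(2) by (auto simp: b_def)
        have 0: "h (b(k := 0)) = 0"
          using insert.prems that(2) by (intro zero) (auto simp: b_def indicator_def)
        have 1: "b(k := 1) = b" using insert by (auto simp: b_def)
        have "(\<lambda>i. if i \<in> insert k U then c i else indicator T i) = b(k := c k)"
          by (auto simp: b_def)
        then have "h (\<lambda>i. if i \<in> insert k U then c i else indicator T i) = c k * h b"
          using affine[where k = k, OF b that(2)] by (simp add: 0 1)
        then show ?case using insert by (simp add: b_def)
      qed
    qed
    have "h (indicator T) = 0"
    proof (cases "card T = d")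
      case False
      have double: "(\<lambda>i. 2 * indicator T i) = (\<lambda>i. if i \<in> T then 2 else indicator T i :: real)"
        by auto
      have "2 ^ d * h (indicator T) = h (\<lambda>i. 2 * indicator T i)"
        by (rule homogeneous [symmetric]) simp
      also have "\<dots> = 2 ^ card T * h (indicator T)"
        unfolding double by (subst expand) auto
      finally have "h (indicator T) * (2 ^ d - 2 ^ card T) = 0" by (simp add: algebra_simps)
      moreover have "(2::real) ^ d \<noteq> 2 ^ card T" using False by simp
      ultimately show ?thesis by (metis mult_eq_0_iff right_minus_eq)
    qed (rule indicator)
    moreover have "(\<lambda>i. if i \<in> T then c i else indicator T i) = c"
      using less.prems(2) by auto
    ultimately show ?case using expand[of T c] less.prems(1) by simp
  qed
  then show ?thesis using c by blast
qed

section \<open>The volume of a zonotope as a function of its lengths\<close>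

text \<open>
  Cauchy's functional equation under monotonicity: comparing \<open>N t\<close> with its integer part gives
  \<open>N * \<bar>g t - t * g 1\<bar> \<le> g 1\<close> for all \<open>N\<close>.
\<close>

lemma additive_nonneg_linear:
  fixes g :: "real \<Rightarrow> real"
  assumes add: "\<And>s t. 0 \<le> s \<Longrightarrow> 0 \<le> t \<Longrightarrow> g (s + t) = g s + g t"
    and nonneg: "\<And>t. 0 \<le> t \<Longrightarrow> 0 \<le> g t" and t: "0 \<le> t"
  shows "g t = t * g 1"
proof -
  have g0: "g 0 = 0" using add[of 0 0] by simp
  have mult: "g (real m * s) = real m * g s" if "0 \<le> s" for m s
  proof (induction m)
    case (Suc m)
    have "g (s + real m * s) = g s + g (real m * s)" using that by (intro add) auto
    then show ?case using Suc by (simp add: algebra_simps)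
  qed (simp add: g0)
  have mono: "g a \<le> g b" if "0 \<le> a" "a \<le> b" for a b
    using add[of a "b - a"] nonneg[of "b - a"] that by simp
  have bound: "real N * \<bar>g t - t * g 1\<bar> \<le> g 1" for N
  proof -
    define m where "m = nat \<lfloor>real N * t\<rfloor>"
    have m: "real m \<le> real N * t" "real N * t \<le> real (Suc m)"
      using t by (auto simp: m_def of_nat_nat) linarith+
    have Nt: "g (real N * t) = real N * g t" using mult t by simp
    have "real m * g 1 \<le> real N * g t" "real N * g t \<le> real (Suc m) * g 1"
      using mono[of "real m" "real N * t"] mono[of "real N * t" "real (Suc m)"] m t
        mult[of 1 m] mult[of 1 "Suc m"] by (simp_all add: Nt)
    moreover have "real m * g 1 \<le> real N * t * g 1" "real N * t * g 1 \<le> real (Suc m) * g 1"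
      using m nonneg[of 1] by (auto intro: mult_right_mono)
    ultimately have "\<bar>real N * g t - real N * t * g 1\<bar> \<le> g 1"
      by (auto simp: abs_le_iff algebra_simps)
    moreover have "real N * g t - real N * t * g 1 = real N * (g t - t * g 1)"
      by (simp add: algebra_simps)
    ultimately show ?thesis by (simp add: abs_mult)
  qed
  show ?thesis
  proof (rule ccontr)
    assume "g t \<noteq> t * g 1"
    then have "0 < \<bar>g t - t * g 1\<bar>" by simp
    then obtain N where "g 1 < real N * \<bar>g t - t * g 1\<bar>"
      using ex_less_of_nat_mult by blast
    with bound[of N] show False by simp
  qed
qed

lemma convex_polytope_segment [simp]: "convex_polytope (closed_segment a b)"
  by (simp add: convex_polytope_def segment_convex_hull polytope_convex_hull)

lemma convex_polytope_sum:
  assumes "\<And>i. i \<in> I \<Longrightarrow> convex_polytope (K i)"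
  shows "convex_polytope (\<Sum>i\<in>I. K i)"
  using assms
  by (induction I rule: infinite_finite_induct) (auto intro: convex_polytope_plus simp del: set_zero)

lemma convex_polytope_imp:
  assumes "convex_polytope K"
  shows "convex K" "compact K" "K \<in> lmeasurable" "K \<noteq> {}"
  using assms
  by (auto simp: convex_polytope_def polytope_imp_convex polytope_imp_compact
      intro!: measurable_convex polytope_imp_bounded)

lemma segment_0: "closed_segment 0 w = {u *\<^sub>R w | u. 0 \<le> u \<and> u \<le> 1}"
  by (auto simp: closed_segment_def)

lemma segment_0_scaled:
  assumes "0 \<le> t"
  shows "closed_segment 0 (t *\<^sub>R w) = {u *\<^sub>R w | u. 0 \<le> u \<and> u \<le> t}"
proof (intro set_eqI iffI)
  fix x assume "x \<in> closed_segment 0 (t *\<^sub>R w)"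
  then show "x \<in> {u *\<^sub>R w | u. 0 \<le> u \<and> u \<le> t}"
    using assms mult_left_le_one_le[of t] by (auto simp: segment_0 mult.commute)
next
  fix x assume "x \<in> {u *\<^sub>R w | u. 0 \<le> u \<and> u \<le> t}"
  then obtain u where u: "x = u *\<^sub>R w" "0 \<le> u" "u \<le> t" by auto
  show "x \<in> closed_segment 0 (t *\<^sub>R w)"
  proof (cases "t = 0")
    case False
    then show ?thesis using u assms
      by (auto simp: segment_0 intro!: exI[of _ "u / t"])
  qed (use u in auto)
qed

lemma add_segment_Un:
  assumes "0 \<le> s" "0 \<le> t"
  shows "K + closed_segment 0 ((s + t) *\<^sub>R w) =
    (K + closed_segment 0 (s *\<^sub>R w)) \<union> (+) (s *\<^sub>R w) ` (K + closed_segment 0 (t *\<^sub>R w))"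
proof (intro equalityI subsetI)
  fix x assume "x \<in> K + closed_segment 0 ((s + t) *\<^sub>R w)"
  then obtain k u where x: "k \<in> K" "x = k + u *\<^sub>R w" "0 \<le> u" "u \<le> s + t"
    using assms by (auto simp: segment_0_scaled set_plus_def)
  show "x \<in> (K + closed_segment 0 (s *\<^sub>R w)) \<union> (+) (s *\<^sub>R w) ` (K + closed_segment 0 (t *\<^sub>R w))"
  proof (cases "u \<le> s")
    case True
    then show ?thesis using x assms by (auto simp: segment_0_scaled set_plus_def)
  next
    case False
    have "x = s *\<^sub>R w + (k + (u - s) *\<^sub>R w)" using x by (simp add: algebra_simps)
    moreover have "k + (u - s) *\<^sub>R w \<in> K + closed_segment 0 (t *\<^sub>R w)"
      using x False assms by (auto simp: segment_0_scaled intro!: set_plus_intro)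
    ultimately show ?thesis by blast
  qed
next
  fix x assume "x \<in> (K + closed_segment 0 (s *\<^sub>R w)) \<union> (+) (s *\<^sub>R w) ` (K + closed_segment 0 (t *\<^sub>R w))"
  then consider k u where "k \<in> K" "0 \<le> u" "u \<le> s" "x = k + u *\<^sub>R w"
    | k u where "k \<in> K" "0 \<le> u" "u \<le> t" "x = k + (s + u) *\<^sub>R w"
    using assms by (auto simp: segment_0_scaled set_plus_def algebra_simps) 
  then show "x \<in> K + closed_segment 0 ((s + t) *\<^sub>R w)"
    by cases (use assms in \<open>auto simp: segment_0_scaled intro!: set_plus_intro\<close>)
qed

text \<open>
  A point in both sets, moved back by \<open>s w\<close>, lies between a point of \<open>K\<close> behind it and a point of \<open>K\<close>
  ahead of it on a line in direction \<open>w\<close>, hence belongs to \<open>K\<close> by convexity.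
\<close>

lemma add_segment_Int:
  assumes "convex K" "0 \<le> s" "0 \<le> t"
  shows "(K + closed_segment 0 (s *\<^sub>R w)) \<inter> (+) (s *\<^sub>R w) ` (K + closed_segment 0 (t *\<^sub>R w)) =
    (+) (s *\<^sub>R w) ` K"
proof (intro equalityI subsetI)
  fix x assume "x \<in> (K + closed_segment 0 (s *\<^sub>R w)) \<inter> (+) (s *\<^sub>R w) ` (K + closed_segment 0 (t *\<^sub>R w))"
  then obtain k u l v where k: "k \<in> K" "0 \<le> u" "u \<le> s" "x = k + u *\<^sub>R w"
    and l: "l \<in> K" "0 \<le> v" "v \<le> t" "x = s *\<^sub>R w + (l + v *\<^sub>R w)"
    using assms by (auto simp: segment_0_scaled set_plus_def)
  define y where "y = x - s *\<^sub>R w"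
  have y: "k = y + (s - u) *\<^sub>R w" "l = y - v *\<^sub>R w"
    using k l by (simp_all add: y_def algebra_simps)
  have "y \<in> K"
  proof (cases "s - u + v = 0")
    case True
    then have "v = 0" using k l by simp
    then show ?thesis using y l by simp
  next
    case False
    then have pos: "0 < s - u + v" using k l by simp
    have "(v / (s - u + v)) *\<^sub>R k + ((s - u) / (s - u + v)) *\<^sub>R l \<in> K"
      using k l pos assms by (intro convexD) (auto simp: add_divide_distrib[symmetric])
    also have "(v / (s - u + v)) *\<^sub>R k + ((s - u) / (s - u + v)) *\<^sub>R l =
        ((v + (s - u)) / (s - u + v)) *\<^sub>R y"
      unfolding y by (simp add: scaleR_right_diff_distrib scaleR_right_distrib
          scaleR_left_distrib add_divide_distrib mult.commute)
    also have "\<dots> = y" using pos by (simp add: add.commute)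
    finally show ?thesis .
  qed
  then show "x \<in> (+) (s *\<^sub>R w) ` K"
    by (auto simp: y_def image_iff intro!: bexI[of _ "x - s *\<^sub>R w"])
next
  fix x assume "x \<in> (+) (s *\<^sub>R w) ` K"
  then obtain k where k: "k \<in> K" "x = k + s *\<^sub>R w" by (auto simp: add.commute)
  have "x \<in> K + closed_segment 0 (s *\<^sub>R w)"
    using k assms by (auto simp: set_plus_def)
  moreover have "k \<in> K + closed_segment 0 (t *\<^sub>R w)"
    using k by (force simp: set_plus_def)
  ultimately show "x \<in> (K + closed_segment 0 (s *\<^sub>R w)) \<inter> (+) (s *\<^sub>R w) ` (K + closed_segment 0 (t *\<^sub>R w))"
    using k by (auto simp: add.commute)
qed

text \<open>
  Sweeping \<open>K\<close> by \<open>[0, (s + t) w]\<close> is sweeping it by \<open>[0, s w]\<close> and then by a translate of \<open>[0, t w]\<close>, and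
  the two pieces overlap in a translate of \<open>K\<close>. So the gain in volume is additive in the length.
\<close>

lemma volume_add_segment:
  fixes K :: "'a::euclidean_space set"
  assumes K: "convex_polytope K" and t: "0 \<le> t"
  shows "measure lebesgue (K + closed_segment 0 (t *\<^sub>R w)) = measure lebesgue K +
    t * (measure lebesgue (K + closed_segment 0 w) - measure lebesgue K)"
proof -
  define V where "V s = measure lebesgue (K + closed_segment 0 (s *\<^sub>R w))" for s
  have meas: "K + closed_segment 0 (s *\<^sub>R w) \<in> lmeasurable" for s
    using K by (intro convex_polytope_imp convex_polytope_plus) auto
  have V0: "V 0 = measure lebesgue K"
    by (simp add: V_def flip: set_zero)
  have add: "V (s + r) + V 0 = V s + V r" if "0 \<le> s" "0 \<le> r" for s r
  proof -
    have "V (s + r) = measure lebesgue (K + closed_segment 0 (s *\<^sub>R w))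
        + measure lebesgue ((+) (s *\<^sub>R w) ` (K + closed_segment 0 (r *\<^sub>R w)))
        - measure lebesgue ((+) (s *\<^sub>R w) ` K)"
      unfolding V_def add_segment_Un[OF that]
        add_segment_Int[OF convex_polytope_imp(1)[OF K] that, symmetric]
      using meas by (intro measure_Un3 measurable_translation)
    then show ?thesis by (simp add: measure_translation V_def V0[unfolded V_def])
  qed
  have mono: "V 0 \<le> V s" if "0 \<le> s" for s
    unfolding V_def
    by (intro measure_mono_fmeasurable fmeasurableD meas set_plus_mono2)
      (use that in \<open>auto simp: segment_0_scaled\<close>)
  have "V t - V 0 = t * (V 1 - V 0)"
  proof (rule additive_nonneg_linear[of "\<lambda>t. V t - V 0", OF _ _ t])
    show "V (s + r) - V 0 = V s - V 0 + (V r - V 0)" if "0 \<le> s" "0 \<le> r" for s r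
      using add[OF that] by simp
  qed (simp add: mono)
  then show ?thesis by (simp add: V_def V0[unfolded V_def])
qed

definition zonotope_of :: "('k::finite \<Rightarrow> 'a::real_vector) \<Rightarrow> 'a set" where
  "zonotope_of w = (\<Sum>k\<in>UNIV. closed_segment 0 (w k))"

lemma volume_zonotope_affine:
  fixes w :: "'k::finite \<Rightarrow> 'a::euclidean_space"
  assumes "0 \<le> t"
  defines "V \<equiv> \<lambda>c. measure lebesgue (zonotope_of (\<lambda>i. c i *\<^sub>R w i))"
  shows "V (c(k := t)) = V (c(k := 0)) + t * (V (c(k := 1)) - V (c(k := 0)))"
proof -
  define K where "K = (\<Sum>i\<in>UNIV - {k}. closed_segment 0 (c i *\<^sub>R w i))"
  have "zonotope_of (\<lambda>i. (c(k := s)) i *\<^sub>R w i) = K + closed_segment 0 (s *\<^sub>R w k)" for s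
    unfolding zonotope_of_def K_def by (subst sum.remove[of _ k]) (auto simp: add.commute)
  then have V: "V (c(k := s)) = measure lebesgue (K + closed_segment 0 (s *\<^sub>R w k))" for s
    by (simp add: V_def)
  have "convex_polytope K" unfolding K_def by (intro convex_polytope_sum) auto
  from volume_add_segment[OF this \<open>0 \<le> t\<close>, of "w k"] show ?thesis
    unfolding V by (simp flip: set_zero)
qed

lemma sum_segments_eq:
  assumes "finite I"
  shows "(\<Sum>k\<in>I. closed_segment 0 (w k)) = {\<Sum>k\<in>I. x k *\<^sub>R w k | x. \<forall>k\<in>I. 0 \<le> x k \<and> x k \<le> 1}"
  using assms
proof (induction I)
  case empty
  then show ?case by auto
next
  case (insert k I)
  have "(\<Sum>k\<in>insert k I. closed_segment 0 (w k)) = closed_segment 0 (w k) +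
      {\<Sum>k\<in>I. x k *\<^sub>R w k | x. \<forall>k\<in>I. 0 \<le> x k \<and> x k \<le> 1}"
    using insert by simp
  also have "\<dots> = {\<Sum>k\<in>insert k I. x k *\<^sub>R w k | x. \<forall>k\<in>insert k I. 0 \<le> x k \<and> x k \<le> 1}"
    (is "?L = ?R")
  proof (intro equalityI subsetI)
    fix z assume "z \<in> ?L"
    then obtain u x where z: "z = u *\<^sub>R w k + (\<Sum>k\<in>I. x k *\<^sub>R w k)" "0 \<le> u" "u \<le> 1"
        "\<forall>k\<in>I. 0 \<le> x k \<and> x k \<le> 1"
      by (auto simp: segment_0 set_plus_def)
    have "(\<Sum>j\<in>insert k I. (x(k := u)) j *\<^sub>R w j) = z"
      using insert z by (auto intro!: sum.cong)
    then show "z \<in> ?R" using z insert by (intro CollectI exI[of _ "x(k := u)"]) auto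
  next
    fix z assume "z \<in> ?R"
    then show "z \<in> ?L" using insert by (auto simp: segment_0 set_plus_def)
  qed
  finally show ?case .
qed

lemma zonotope_of_eq: "zonotope_of w = {\<Sum>k\<in>UNIV. x k *\<^sub>R w k | x. \<forall>k. 0 \<le> x k \<and> x k \<le> 1}"
  unfolding zonotope_of_def by (simp add: sum_segments_eq)

lemma volume_zonotope_scale:
  fixes w :: "'k::finite \<Rightarrow> 'a::euclidean_space"
  shows "measure lebesgue (zonotope_of (\<lambda>k. c *\<^sub>R w k)) =
    \<bar>c\<bar> ^ DIM('a) * measure lebesgue (zonotope_of w)"
proof -
  have "zonotope_of (\<lambda>k. c *\<^sub>R w k) = (*\<^sub>R) c ` zonotope_of w"
  proof -
    have "(\<Sum>k\<in>UNIV. x k *\<^sub>R c *\<^sub>R w k) = c *\<^sub>R (\<Sum>k\<in>UNIV. x k *\<^sub>R w k)" for x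
      by (simp add: scaleR_sum_right mult.commute)
    then show ?thesis unfolding zonotope_of_eq setcompr_eq_image image_image by simp
  qed
  then show ?thesis
    using measure_lebesgue_affine[of c 0 "zonotope_of w"] by (simp only: add_0_right)
qed

lemma content_unit_cbox_cart: "measure lebesgue (cbox 0 1 :: (real^'n) set) = 1"
proof -
  have "cbox 0 (1::real^'n) \<noteq> {}" by (simp add: interval_ne_empty_cart)
  then show ?thesis by (simp add: content_cbox_cart)
qed

lemma volume_parallelepiped:
  fixes w :: "'n::{finite,wellorder} \<Rightarrow> real^'n::_"
  shows "measure lebesgue (zonotope_of w) = \<bar>det (\<chi> i. w i)\<bar>"
proof -
  define A where "A = transpose (\<chi> i. w i)"
  have A: "A $ i $ j = w j $ i" for i j unfolding A_def transpose_def by simp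
  have Ax: "A *v x = (\<Sum>k\<in>UNIV. x $ k *\<^sub>R w k)" for x
    unfolding vec_eq_iff matrix_vector_mult_def by (simp add: A mult.commute)
  have "zonotope_of w = (*v) A ` cbox 0 1"
  proof (intro equalityI subsetI)
    fix z assume "z \<in> zonotope_of w"
    then obtain x where x: "z = (\<Sum>k\<in>UNIV. x k *\<^sub>R w k)" "\<forall>k. 0 \<le> x k \<and> x k \<le> 1"
      unfolding zonotope_of_eq by blast
    then show "z \<in> (*v) A ` cbox 0 1"
      by (intro image_eqI[of _ _ "\<chi> k. x k"]) (simp_all add: Ax mem_box_cart)
  next
    fix z assume "z \<in> (*v) A ` cbox 0 1"
    then obtain x where "z = A *v x" "x \<in> cbox 0 1" by blast
    then show "z \<in> zonotope_of w"
      unfolding zonotope_of_eq by (intro CollectI exI[of _ "($) x"]) (simp add: Ax mem_box_cart)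
  qed
  then have "measure lebesgue (zonotope_of w) =
      \<bar>det (matrix ((*v) A))\<bar> * measure lebesgue (cbox 0 1 :: (real^'n::_) set)"
    by (simp only: measure_linear_image matrix_vector_mul_linear lmeasurable_cbox)
  also have "matrix ((*v) A) = A" by simp
  also have "det A = det (\<chi> i. w i)" unfolding A_def by (rule det_transpose)
  also have "measure lebesgue (cbox 0 1 :: (real^'n::_) set) = 1"
    by (rule content_unit_cbox_cart)
  finally show ?thesis by simp
qed

section \<open>Volume of graphic zonotopes as a determinant\<close>

lemma det_scaleR: "det (t *\<^sub>R M) = t ^ CARD('n) * det M" for M :: "real^'n^'n"
proof -
  have "t *\<^sub>R M = (\<chi> i. t *s M $ i)" by (simp add: vec_eq_iff)
  then show ?thesis using det_rows_mul[of "\<lambda>_. t" "\<lambda>i. M $ i"] by simp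
qed

definition weighted_laplacian :: "('k::finite \<Rightarrow> real^'n) \<Rightarrow> ('k \<Rightarrow> real) \<Rightarrow> real^'n^'n" where
  "weighted_laplacian z c = (\<Sum>k\<in>UNIV. c k *\<^sub>R outer (z k))"

text \<open>
  The all-ones vector as an additional generator, under the index \<^const>\<open>None\<close>.
\<close>

definition with_ones :: "('k \<Rightarrow> real^'n) \<Rightarrow> 'k option \<Rightarrow> real^'n" where
  "with_ones w k = (case k of None \<Rightarrow> 1 | Some k \<Rightarrow> w k)"

text \<open>
  Both sides are affine in every \<open>c k\<close> and homogeneous of degree \<open>n\<close>, so it suffices to compare them on
  the indicator of a set \<open>S\<close> of \<open>n\<close> generators. If the all-ones vector is not in \<open>S\<close>, the zonotope lies
  in a hyperplane and both sides are \<open>0\<close>; otherwise \<open>abs_det_eq_sum_det_outer\<close> applies.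
\<close>

theorem volume_eq_sum_minors:
  fixes z w :: "'k::finite \<Rightarrow> real^'n::{finite,wellorder}"
  assumes z: "\<And>k. graphic (z k)" and \<delta>: "\<And>k. 0 \<le> \<delta> k"
    and w: "\<And>k. w k = \<delta> k *s z k - \<epsilon> k *s 1" and w0: "\<And>k. w k \<bullet> 1 = 0"
    and c: "\<And>k. 0 \<le> c k"
  defines "L \<equiv> \<lambda>c. weighted_laplacian z (\<lambda>k. c (Some k) * \<delta> k)"
  shows "measure lebesgue (zonotope_of (\<lambda>k. c k *\<^sub>R with_ones w k)) =
    (\<Sum>v\<in>UNIV. det (L c + c None *\<^sub>R outer (axis v 1)) - det (L c))"
proof -
  define V where "V c = measure lebesgue (zonotope_of (\<lambda>k. c k *\<^sub>R with_ones w k))"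
    for c :: "'k option \<Rightarrow> real"
  define G where "G c = (\<Sum>v\<in>UNIV. det (L c + c None *\<^sub>R outer (axis v 1)) - det (L c))"
    for c :: "'k option \<Rightarrow> real"
  have L_None: "L (c(None := t)) = L c" for c t by (simp add: L_def)
  have L_Some: "L (c(Some k := t)) = L (c(Some k := 0)) + t *\<^sub>R (\<delta> k *\<^sub>R outer (z k))" for c k t
    unfolding L_def weighted_laplacian_def by (simp add: sum.remove[of UNIV k])
  have det_affine: "det (M + t *\<^sub>R (d *\<^sub>R outer y)) =
      det M + t * (det (M + d *\<^sub>R outer y) - det M)" for M t d and y :: "real^'n::_"
    using det_add_outer[of M "t * d" y] det_add_outer[of M d y] by simp
  have det_affine': "det (M + t *\<^sub>R (d *\<^sub>R outer y) + N) =
      det (M + N) + t * (det (M + d *\<^sub>R outer y + N) - det (M + N))"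
    for M N t d and y :: "real^'n::_"
    using det_affine[of "M + N" t d y] by (simp add: ac_simps)
  have G_affine: "G (c(k := t)) = G (c(k := 0)) + t * (G (c(k := 1)) - G (c(k := 0)))" for c k t
  proof (cases k)
    case None
    show ?thesis
      unfolding G_def None L_None fun_upd_same det_add_outer[of _ t]
      by (simp add: sum_distrib_left algebra_simps flip: sum.distrib sum_subtractf)
  next
    case (Some j)
    let ?s = "c None"
    have [simp]: "(c(Some j := t)) None = ?s" for t by simp
    show ?thesis
      unfolding G_def Some fun_upd_other[OF option.distinct(1)] L_Some[of c j t] L_Some[of c j 1]
        det_affine[of _ t] det_affine'[of _ t]
      by (simp add: sum_distrib_left algebra_simps flip: sum.distrib sum_subtractf)
  qed
  have G_scale: "G (\<lambda>k. 2 * c k) = 2 ^ CARD('n) * G c" for c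
  proof -
    have "L (\<lambda>k. 2 * c k) = 2 *\<^sub>R L c"
      by (simp add: L_def weighted_laplacian_def scaleR_sum_right mult.assoc)
    then show ?thesis
      unfolding G_def by (simp only: sum_distrib_left right_diff_distrib det_scaleR
          scaleR_right_distrib[symmetric] scaleR_scaleR[symmetric])
  qed
  have V_scale: "V (\<lambda>k. 2 * c k) = 2 ^ CARD('n) * V c" for c
    using volume_zonotope_scale[of 2 "\<lambda>k. c k *\<^sub>R with_ones w k"] by (simp add: V_def)
  have indicator: "V (indicator S) = G (indicator S)" if S: "card S = CARD('n)" for S :: "'k option set"
  proof -
    have "finite S" by simp
    \<comment> \<open>\<open>S\<close> is enumerated by the row index type, which makes its generators the rows of a matrix\<close>
    then obtain \<pi> where \<pi>: "bij_betw \<pi> (UNIV :: 'n set) S"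
      using S by (metis finite_class.finite_UNIV bij_betw_iff_card)
    have "zonotope_of (\<lambda>k. indicator S k *\<^sub>R with_ones w k) =
        (\<Sum>k\<in>S. closed_segment 0 (with_ones w k))"
      unfolding zonotope_of_def
      by (rule sum.mono_neutral_cong_right) (auto simp flip: set_zero)
    also have "\<dots> = zonotope_of (\<lambda>i. with_ones w (\<pi> i))"
      unfolding zonotope_of_def by (rule sum.reindex_bij_betw[OF \<pi>, symmetric])
    finally have VS: "V (indicator S) = \<bar>det (\<chi> i. with_ones w (\<pi> i))\<bar>"
      by (simp add: V_def volume_parallelepiped)
    show ?thesis
    proof (cases "None \<in> S")
      case False
      then have \<pi>Some: "\<exists>k. \<pi> i = Some k" for i
        using \<pi> by (metis UNIV_I bij_betwE not_None_eq)
      have "with_ones w (\<pi> i) \<bullet> 1 = 0" for i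
        using \<pi>Some[of i] w0 by (auto simp: with_ones_def)
      then have "(\<chi> i. with_ones w (\<pi> i)) *v 1 = 0"
        by (simp add: vec_eq_iff matrix_mult_dot)
      then have "det (\<chi> i. with_ones w (\<pi> i)) = 0"
        by (metis invertible_det_nz invertible_left_inverse matrix_left_invertible_ker one_neq_zero)
      then show ?thesis using False VS by (simp add: G_def)
    next
      case True
      then obtain p where p: "\<pi> p = None" using \<pi> by (metis bij_betw_iff_bijections)
      define \<kappa> where "\<kappa> i = the (\<pi> i)" for i
      have \<kappa>: "\<pi> i = Some (\<kappa> i)" if "i \<noteq> p" for i
        using that \<pi> p by (metis UNIV_I \<kappa>_def bij_betw_def inj_on_def option.exhaust_sel)
      have bij: "bij_betw \<pi> (UNIV - {p}) (S - {None})"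
        using bij_betw_DiffI[OF \<pi>, of "{p}" "{None}"] p True by simp
      have "L (indicator S) = (\<Sum>k\<in>Some -` S. \<delta> k *\<^sub>R outer (z k))"
        unfolding L_def weighted_laplacian_def
        by (rule sum.mono_neutral_cong_right) (auto simp: indicator_def)
      also have "\<dots> = (\<Sum>x\<in>S - {None}. \<delta> (the x) *\<^sub>R outer (z (the x)))"
        by (rule sum.reindex_bij_witness[of _ the Some]) auto
      also have "\<dots> = (\<Sum>i\<in>UNIV - {p}. \<delta> (\<kappa> i) *\<^sub>R outer (z (\<kappa> i)))"
        unfolding \<kappa>_def by (rule sum.reindex_bij_betw[OF bij, symmetric])
      finally have L: "L (indicator S) = (\<Sum>i\<in>UNIV - {p}. \<delta> (\<kappa> i) *\<^sub>R outer (z (\<kappa> i)))" .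
      have "(\<chi> i. with_ones w (\<pi> i)) =
          (\<chi> i. if i = p then 1 else \<delta> (\<kappa> i) *s z (\<kappa> i) - \<epsilon> (\<kappa> i) *s 1)"
        by (simp add: vec_eq_iff with_ones_def p \<kappa> w)
      then have "V (indicator S) =
          \<bar>det (\<chi> i. if i = p then 1 else \<delta> (\<kappa> i) *s z (\<kappa> i) - \<epsilon> (\<kappa> i) *s 1)\<bar>"
        by (simp only: VS)
      also have "\<dots> = G (indicator S)"
        unfolding abs_det_eq_sum_det_outer[OF z \<delta>] G_def L using True by simp
      finally show ?thesis .
    qed
  qed
  have "V c - G c = 0"
  proof (rule multiaffine_homogeneous_eq_0[where h = "\<lambda>c. V c - G c" and d = "CARD('n)"])
    fix c :: "'k option \<Rightarrow> real" and k t assume "0 \<le> (t::real)"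
    then have "V (c(k := t)) = V (c(k := 0)) + t * (V (c(k := 1)) - V (c(k := 0)))"
      unfolding V_def by (rule volume_zonotope_affine)
    then show "V (c(k := t)) - G (c(k := t)) = V (c(k := 0)) - G (c(k := 0)) +
        t * (V (c(k := 1)) - G (c(k := 1)) - (V (c(k := 0)) - G (c(k := 0))))"
      using G_affine[of c k t] by (simp add: algebra_simps)
  qed (use c in \<open>simp_all add: G_scale V_scale indicator right_diff_distrib\<close>)
  then show ?thesis by (simp add: V_def G_def)
qed

section \<open>Volume in a hyperplane\<close>

text \<open>
  Orthogonal maps preserve Lebesgue measure; this carries the defining property of \<^const>\<open>lborel\<close> from
  the standard basis to any other orthonormal basis.
\<close>

lemma lborel_orthonormal_basis:
  fixes C :: "(real^'n::{finite,wellorder}) set"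
  assumes C: "finite C" "card C = CARD('n)" "pairwise orthogonal C" "\<And>c. c \<in> C \<Longrightarrow> norm c = 1"
  shows "distr (\<Pi>\<^sub>M c\<in>C. lborel) borel (\<lambda>f. \<Sum>c\<in>C. f c *\<^sub>R c) = lborel"
proof -
  interpret product_sigma_finite "\<lambda>_::real^'n::_. lborel :: real measure" by standard
  have "card (Basis :: (real^'n::_) set) = card C" using C by simp
  then obtain g where g: "bij_betw g (Basis :: (real^'n::_) set) C"
    using C(1) finite_Basis by (metis bij_betw_iff_card)
  have orth: "g b \<bullet> g b' = (if b = b' then 1 else 0)" if "b \<in> Basis" "b' \<in> Basis" for b b'
  proof -
    have "g b \<in> C" "g b' \<in> C" using g that by (auto dest: bij_betwE)
    moreover have "g b = g b' \<longleftrightarrow> b = b'" using g that by (auto simp: bij_betw_def inj_on_def)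
    ultimately show ?thesis using C(3,4)
      by (auto simp: pairwise_def orthogonal_def dot_square_norm)
  qed
  define T where "T x = (\<Sum>b\<in>Basis. (x \<bullet> b) *\<^sub>R g b)" for x :: "real^'n::_"
  have T: "orthogonal_transformation T"
    unfolding orthogonal_transformation_def
  proof (intro conjI allI)
    show "linear T"
      unfolding T_def by (intro linearI)
        (simp_all add: inner_add_left scaleR_left_distrib sum.distrib scaleR_sum_right)
    show "T v \<bullet> T w = v \<bullet> w" for v w
    proof -
      have "g b \<bullet> T w = w \<bullet> b" if "b \<in> Basis" for b
        unfolding T_def using that by (simp add: inner_sum_right orth if_distrib cong: if_cong sum.cong)
      then have "(\<Sum>b\<in>Basis. (v \<bullet> b) * (g b \<bullet> T w)) = (\<Sum>b\<in>Basis. (v \<bullet> b) * (w \<bullet> b))"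
        by simp
      moreover have "T v \<bullet> T w = (\<Sum>b\<in>Basis. (v \<bullet> b) * (g b \<bullet> T w))"
        by (subst T_def) (simp add: inner_sum_left)
      ultimately show ?thesis by (simp add: euclidean_inner[of v w])
    qed
  qed
  have bijT: "bij T" using T by (rule orthogonal_transformation_bij)
  have Tsum: "T (\<Sum>b\<in>Basis. f b *\<^sub>R b) = (\<Sum>b\<in>Basis. f b *\<^sub>R g b)" for f
    unfolding T_def by (intro sum.cong refl) (simp add: inner_sum_left_Basis)
  have contT: "continuous_on UNIV T"
    using orthogonal_transformation_linear[OF T]
    by (intro linear_continuous_on) (simp add: linear_conv_bounded_linear)
  \<comment> \<open>renames the coordinates along \<open>g\<close>\<close>
  let ?\<sigma> = "\<lambda>f. \<lambda>c\<in>C. f (the_inv_into Basis g c) :: real"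
  have \<sigma>[measurable]: "?\<sigma> \<in> (\<Pi>\<^sub>M b\<in>Basis. lborel) \<rightarrow>\<^sub>M (\<Pi>\<^sub>M c\<in>C. lborel)"
    by (intro measurable_restrict measurable_component_singleton)
      (metis bij_betw_def g the_inv_into_into subset_refl)
  have PiC: "distr (\<Pi>\<^sub>M b\<in>Basis. lborel) (\<Pi>\<^sub>M c\<in>C. lborel) ?\<sigma> = (\<Pi>\<^sub>M c\<in>C. lborel)"
  proof (rule PiM_eqI)
    fix A :: "real^'n::_ \<Rightarrow> real set" assume A: "\<And>c. c \<in> C \<Longrightarrow> A c \<in> sets lborel"
    have inv: "the_inv_into Basis g (g b) = b" "g b \<in> C" if "b \<in> Basis" for b
      using g that by (auto simp: bij_betw_def the_inv_into_f_f)
    have "?\<sigma> -` (\<Pi>\<^sub>E c\<in>C. A c) \<inter> space (\<Pi>\<^sub>M b\<in>Basis. lborel) = (\<Pi>\<^sub>E b\<in>Basis. A (g b))"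
    proof (intro set_eqI)
      fix f
      have "(\<forall>c\<in>C. f (the_inv_into Basis g c) \<in> A c) \<longleftrightarrow> (\<forall>b\<in>Basis. f b \<in> A (g b))"
        using g inv by (auto simp: bij_betw_def)
      then show "f \<in> ?\<sigma> -` (\<Pi>\<^sub>E c\<in>C. A c) \<inter> space (\<Pi>\<^sub>M b\<in>Basis. lborel) \<longleftrightarrow>
          f \<in> (\<Pi>\<^sub>E b\<in>Basis. A (g b))"
        by (auto simp: space_PiM PiE_iff)
    qed
    then have "emeasure (distr (\<Pi>\<^sub>M b\<in>Basis. lborel) (\<Pi>\<^sub>M c\<in>C. lborel) ?\<sigma>) (\<Pi>\<^sub>E c\<in>C. A c) =
        emeasure (\<Pi>\<^sub>M b\<in>Basis. lborel) (\<Pi>\<^sub>E b\<in>Basis. A (g b))"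
      using A C(1) by (subst emeasure_distr) (auto intro!: sets_PiM_I_finite)
    also have "\<dots> = (\<Prod>b\<in>Basis. emeasure lborel (A (g b)))"
      using A inv by (intro emeasure_PiM) auto
    also have "\<dots> = (\<Prod>c\<in>C. emeasure lborel (A c))"
      by (rule prod.reindex_bij_betw[OF g])
    finally show "emeasure (distr (\<Pi>\<^sub>M b\<in>Basis. lborel) (\<Pi>\<^sub>M c\<in>C. lborel) ?\<sigma>) (\<Pi>\<^sub>E c\<in>C. A c) =
        (\<Prod>c\<in>C. emeasure lborel (A c))" .
  qed (use C in auto)
  have "distr (\<Pi>\<^sub>M c\<in>C. lborel) borel (\<lambda>f. \<Sum>c\<in>C. f c *\<^sub>R c) =
      distr (\<Pi>\<^sub>M b\<in>Basis. lborel) borel (\<lambda>f. \<Sum>c\<in>C. ?\<sigma> f c *\<^sub>R c)"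
    by (subst PiC[symmetric], subst distr_distr) (auto simp: comp_def)
  also have "(\<lambda>f. \<Sum>c\<in>C. ?\<sigma> f c *\<^sub>R c) = (\<lambda>f. T (\<Sum>b\<in>Basis. f b *\<^sub>R b))"
  proof
    fix f :: "real^'n::_ \<Rightarrow> real"
    have "(\<Sum>c\<in>C. ?\<sigma> f c *\<^sub>R c) = (\<Sum>c\<in>C. f (the_inv_into Basis g c) *\<^sub>R c)"
      by (intro sum.cong) auto
    also have "\<dots> = (\<Sum>b\<in>Basis. f (the_inv_into Basis g (g b)) *\<^sub>R g b)"
      by (rule sum.reindex_bij_betw[OF g, symmetric])
    also have "\<dots> = (\<Sum>b\<in>Basis. f b *\<^sub>R g b)"
      using g by (intro sum.cong) (auto simp: bij_betw_def the_inv_into_f_f)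
    finally show "(\<Sum>c\<in>C. ?\<sigma> f c *\<^sub>R c) = T (\<Sum>b\<in>Basis. f b *\<^sub>R b)" by (simp add: Tsum)
  qed
  also have "distr (\<Pi>\<^sub>M b\<in>Basis. lborel) borel (\<lambda>f. T (\<Sum>b\<in>Basis. f b *\<^sub>R b)) =
      distr (lborel :: (real^'n::_) measure) borel T"
    using borel_measurable_continuous_onI[OF contT]
    by (subst lborel_eq[where 'a = "real^'n::_"], subst distr_distr) (auto simp: comp_def)
  also have "\<dots> = lborel"
  proof (rule lborel_eqI[symmetric])
    fix l u :: "real^'n::_" assume "\<And>b. b \<in> Basis \<Longrightarrow> l \<bullet> b \<le> u \<bullet> b"
    let ?S = "T -` box l u"
    have S: "?S = inv T ` box l u" using bijT by (simp add: bij_vimage_eq_inv_image)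
    have "?S \<in> lmeasurable"
      unfolding S using T by (intro measurable_orthogonal_image orthogonal_transformation_inv) auto
    then have "measure lebesgue (T ` ?S) = measure lebesgue ?S"
      by (rule measure_orthogonal_image[OF T])
    moreover have "T ` ?S = box l u" using bijT by (simp add: bij_is_surj surj_image_vimage_eq)
    moreover have Sborel: "?S \<in> sets borel"
      using measurable_sets[OF borel_measurable_continuous_onI[OF contT], of "box l u"] by simp
    ultimately have "measure lborel ?S = measure lborel (box l u)"
      by (simp add: measure_completion)
    moreover have "emeasure lborel ?S < \<infinity>"
      using \<open>?S \<in> lmeasurable\<close> Sborel by (auto simp: fmeasurable_def emeasure_completion)
    ultimately have "emeasure lborel ?S = emeasure lborel (box l u)"
      using emeasure_bounded_finite[OF bounded_box[of l u]]
      by (simp add: emeasure_eq_ennreal_measure less_top)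
    then show "emeasure (distr lborel borel T) (box l u) = (\<Prod>b\<in>Basis. (u - l) \<bullet> b)"
      using borel_measurable_continuous_onI[OF contT] \<open>\<And>b. b \<in> Basis \<Longrightarrow> l \<bullet> b \<le> u \<bullet> b\<close>
      by (simp add: emeasure_distr emeasure_lborel_box)
  qed simp
  finally show ?thesis .
qed

lemma subspace_lborel_obtain_basis:
  assumes "subspace V"
  obtains B where "pairwise orthogonal B" "\<And>b. b \<in> B \<Longrightarrow> norm b = 1" "span B = V"
    "subspace_lborel V = distr (\<Pi>\<^sub>M b\<in>B. lborel) borel (\<lambda>f. \<Sum>b\<in>B. f b *\<^sub>R b)"
proof -
  define P where "P B \<longleftrightarrow> pairwise orthogonal B \<and> (\<forall>b\<in>B. norm b = 1) \<and> span B = V" for B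
  have "\<exists>B. P B" using orthonormal_basis_subspace[OF assms] unfolding P_def by metis
  then have "P (SOME B. P B)" by (rule someI_ex)
  then show ?thesis
    by (intro that[of "SOME B. P B"]) (auto simp: P_def subspace_lborel_def Let_def)
qed

lemma compact_set_plus:
  fixes A B :: "'a::real_normed_vector set"
  assumes "compact A" "compact B"
  shows "compact (A + B)"
proof -
  have "A + B = {a + b | a b. a \<in> A \<and> b \<in> B}" unfolding set_plus_def by blast
  then show ?thesis using compact_sums[OF assms] by simp
qed

text \<open>
  Extending the orthonormal basis of the hyperplane by \<open>u\<close> gives one of the whole space, and Fubini's
  theorem separates the coordinate along \<open>u\<close>, which ranges over \<open>[0, 1]\<close>.
\<close>

lemma emeasure_subspace_lborel_hyperplane:
  fixes u :: "real^'n::{finite,wellorder}"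
  assumes u: "norm u = 1" and A: "compact A" "A \<subseteq> {x. u \<bullet> x = 0}"
  shows "emeasure (subspace_lborel {x. u \<bullet> x = 0}) A = emeasure lborel (A + closed_segment 0 u)"
proof -
  let ?V = "{x. u \<bullet> x = 0}"
  interpret product_sigma_finite "\<lambda>_::real^'n::_. lborel :: real measure" by standard
  have V: "subspace ?V" by (rule subspace_hyperplane)
  obtain B where B: "pairwise orthogonal B" "\<And>b. b \<in> B \<Longrightarrow> norm b = 1" "span B = ?V"
    and sub: "subspace_lborel ?V = distr (\<Pi>\<^sub>M b\<in>B. lborel) borel (\<lambda>f. \<Sum>b\<in>B. f b *\<^sub>R b)"
    by (rule subspace_lborel_obtain_basis[OF V]) (rule that; assumption)
  have BV: "u \<bullet> b = 0" if "b \<in> B" for b using B(3) that span_base by blast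
  have indep: "independent B" using B(1) B(2)[of 0] by (intro pairwise_orthogonal_independent) auto
  then have fin: "finite B" by (rule independent_imp_finite)
  have "u \<bullet> u = 1" using u by (simp add: norm_eq_1)
  then have uB: "u \<notin> B" and u0: "u \<noteq> 0" using BV by force+
  have "card B = dim ?V" using indep B(3) by (metis dim_span_eq_card_independent)
  also have "\<dots> = CARD('n) - 1" using dim_hyperplane[OF u0] by simp
  finally have card: "card (insert u B) = CARD('n)" using fin uB by simp
  have lb: "distr (\<Pi>\<^sub>M c\<in>insert u B. lborel) borel (\<lambda>f. \<Sum>c\<in>insert u B. f c *\<^sub>R c) = lborel"
    using fin card B(1,2) BV u
    by (intro lborel_orthonormal_basis)
      (auto simp: pairwise_insert orthogonal_def inner_commute)
  let ?S = "A + closed_segment 0 u"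
  have S[measurable]: "?S \<in> sets borel" and Ab[measurable]: "A \<in> sets borel"
    using A by (auto intro!: borel_compact compact_set_plus)
  have split: "y *\<^sub>R u + v \<in> ?S \<longleftrightarrow> v \<in> A \<and> 0 \<le> y \<and> y \<le> 1" if "u \<bullet> v = 0" for y v
  proof
    assume "y *\<^sub>R u + v \<in> ?S"
    then obtain a t where a: "a \<in> A" "0 \<le> t" "t \<le> 1" "y *\<^sub>R u + v = a + t *\<^sub>R u"
      by (auto simp: set_plus_def segment_0)
    then have "u \<bullet> (y *\<^sub>R u + v) = u \<bullet> (a + t *\<^sub>R u)" by simp
    then have "y = t" using a(1) A(2) that \<open>u \<bullet> u = 1\<close> by (auto simp: inner_add_right)
    then show "v \<in> A \<and> 0 \<le> y \<and> y \<le> 1" using a by (simp add: add.commute)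
  next
    assume "v \<in> A \<and> 0 \<le> y \<and> y \<le> 1"
    then have "v + y *\<^sub>R u \<in> ?S" by (intro set_plus_intro) (auto simp: segment_0)
    then show "y *\<^sub>R u + v \<in> ?S" by (simp add: add.commute)
  qed
  have "emeasure lborel ?S =
      (\<integral>\<^sup>+f. indicator ?S (\<Sum>c\<in>insert u B. f c *\<^sub>R c) \<partial>(\<Pi>\<^sub>M c\<in>insert u B. lborel))"
    by (subst lb[symmetric], subst nn_integral_indicator[symmetric], simp, subst nn_integral_distr) auto
  also have "\<dots> = (\<integral>\<^sup>+x. (\<integral>\<^sup>+y. indicator ?S (\<Sum>c\<in>insert u B. (x(u := y)) c *\<^sub>R c) \<partial>lborel)
      \<partial>(\<Pi>\<^sub>M c\<in>B. lborel))"
    using fin uB by (intro product_nn_integral_insert) auto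
  also have "\<dots> = (\<integral>\<^sup>+x. (\<integral>\<^sup>+y. indicator A (\<Sum>c\<in>B. x c *\<^sub>R c) * indicator {0..1::real} y \<partial>lborel)
      \<partial>(\<Pi>\<^sub>M c\<in>B. lborel))"
  proof (intro nn_integral_cong)
    fix x :: "real^'n::_ \<Rightarrow> real" and y :: real
    have "(\<Sum>c\<in>insert u B. (x(u := y)) c *\<^sub>R c) = y *\<^sub>R u + (\<Sum>c\<in>B. x c *\<^sub>R c)"
      using fin uB by (auto intro!: sum.cong)
    moreover have "u \<bullet> (\<Sum>c\<in>B. x c *\<^sub>R c) = 0" using BV by (simp add: inner_sum_right)
    ultimately show "(indicator ?S (\<Sum>c\<in>insert u B. (x(u := y)) c *\<^sub>R c) :: ennreal) =
        indicator A (\<Sum>c\<in>B. x c *\<^sub>R c) * indicator {0..1} y"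
      using split by (auto simp: indicator_def)
  qed
  also have "\<dots> = (\<integral>\<^sup>+x. indicator A (\<Sum>c\<in>B. x c *\<^sub>R c) \<partial>(\<Pi>\<^sub>M c\<in>B. lborel))"
    by (simp add: nn_integral_cmult)
  also have "\<dots> = emeasure (subspace_lborel ?V) A"
    unfolding sub by (subst nn_integral_indicator[symmetric], simp, subst nn_integral_distr) auto
  finally show ?thesis ..
qed

definition unit_normal :: "real^'n" where
  "unit_normal = (1 / sqrt CARD('n)) *\<^sub>R 1"

lemma sum_zero_hyperplane_eq: "sum_zero_hyperplane = {x. unit_normal \<bullet> x = 0}"
  by (simp add: sum_zero_hyperplane_def unit_normal_def inner_vec_def flip: sum_divide_distrib)

lemma norm_unit_normal: "norm (unit_normal :: real^'n) = 1"
  by (simp add: unit_normal_def norm_vec_def L2_set_def power_divide)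

lemma volume_along_sum_zero_hyperplane:
  fixes K :: "(real^'n::{finite,wellorder}) set"
  assumes K: "convex_polytope K" and flat: "\<And>x y. x \<in> K \<Longrightarrow> y \<in> K \<Longrightarrow> x - y \<in> sum_zero_hyperplane"
  shows "volume_along sum_zero_hyperplane K = measure lebesgue (K + closed_segment 0 unit_normal)"
proof -
  define p where "p = (SOME p. p \<in> K)"
  have p: "p \<in> K" using convex_polytope_imp(4)[OF K] by (simp add: p_def some_in_eq)
  define A where "A = (\<lambda>x. x - p) ` K"
  have A: "compact A" "A \<subseteq> {x. unit_normal \<bullet> x = 0}"
    using convex_polytope_imp(2)[OF K] flat p
    by (auto simp: A_def compact_translation_subtract simp flip: sum_zero_hyperplane_eq)
  have "volume_along sum_zero_hyperplane K = measure (subspace_lborel {x. unit_normal \<bullet> x = 0}) A"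
    by (simp add: volume_along_def A_def p_def sum_zero_hyperplane_eq)
  also have "\<dots> = measure lborel (A + closed_segment 0 unit_normal)"
    unfolding measure_def
    by (simp add: emeasure_subspace_lborel_hyperplane[OF norm_unit_normal A])
  also have "\<dots> = measure lebesgue (A + closed_segment 0 unit_normal)"
    by (rule measure_completion[symmetric])
      (simp add: A compact_set_plus borel_compact)
  also have "A + closed_segment 0 unit_normal = (\<lambda>x. x - p) ` (K + closed_segment 0 unit_normal)"
    by (auto simp: A_def set_plus_def image_iff algebra_simps) blast+
  finally show ?thesis by (simp add: measure_translation_subtract)
qed

section \<open>Cancellation and virtual zonotopes\<close>

lemma scaleR_add_convex:
  assumes "convex K" "0 \<le> a" "0 \<le> b"
  shows "(*\<^sub>R) (a + b) ` K = (*\<^sub>R) a ` K + (*\<^sub>R) b ` K"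
proof (intro equalityI subsetI)
  fix x assume "x \<in> (*\<^sub>R) (a + b) ` K"
  then show "x \<in> (*\<^sub>R) a ` K + (*\<^sub>R) b ` K"
    by (auto simp: scaleR_left_distrib intro: set_plus_intro)
next
  fix x assume "x \<in> (*\<^sub>R) a ` K + (*\<^sub>R) b ` K"
  then obtain k l where kl: "k \<in> K" "l \<in> K" "x = a *\<^sub>R k + b *\<^sub>R l"
    by (auto simp: set_plus_def)
  show "x \<in> (*\<^sub>R) (a + b) ` K"
  proof (cases "a + b = 0")
    case True
    then have "a = 0" "b = 0" using assms by auto
    then show ?thesis using kl by auto
  next
    case False
    then have "(a / (a + b)) *\<^sub>R k + (b / (a + b)) *\<^sub>R l \<in> K"
      using assms kl by (intro convexD) (auto simp: add_divide_distrib[symmetric])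
    moreover have "x = (a + b) *\<^sub>R ((a / (a + b)) *\<^sub>R k + (b / (a + b)) *\<^sub>R l)"
      using False by (simp add: kl scaleR_right_distrib)
    ultimately show ?thesis by blast
  qed
qed

text \<open>
  A point \<open>a\<close> of \<open>A\<close> outside \<open>B\<close> can be separated from \<open>B\<close> by a linear functional \<open>w\<close>. Adding a point of
  \<open>M\<close> where \<open>w\<close> is minimal yields a point of \<open>A + M\<close> on which \<open>w\<close> is smaller than on all of \<open>B + M\<close>.
\<close>

lemma set_plus_le_cancel:
  fixes A B M :: "'a::euclidean_space set"
  assumes sub: "A + M \<subseteq> B + M" and B: "closed B" "convex B" and M: "compact M" "M \<noteq> {}"
  shows "A \<subseteq> B"
proof
  fix a assume a: "a \<in> A"
  show "a \<in> B"
  proof (rule ccontr)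
    assume "a \<notin> B"
    then obtain w \<beta> where w: "w \<bullet> a < \<beta>" "\<And>x. x \<in> B \<Longrightarrow> \<beta> < w \<bullet> x"
      using separating_hyperplane_closed_point[OF B(2,1)] by blast
    obtain m where m: "m \<in> M" "\<And>y. y \<in> M \<Longrightarrow> w \<bullet> m \<le> w \<bullet> y"
      using continuous_attains_inf[OF M continuous_on_inner[OF continuous_on_const continuous_on_id]]
      by blast
    have "a + m \<in> B + M" using sub a m by (blast intro: set_plus_intro)
    then obtain b y where b: "b \<in> B" "y \<in> M" "a + m = b + y" by (rule set_plus_elim)
    then have "w \<bullet> a + w \<bullet> m = w \<bullet> b + w \<bullet> y" by (metis inner_add_right)
    with w(1) w(2)[OF b(1)] m(2)[OF b(2)] show False by linarith
  qed
qed

lemma convex_polytope_cancel: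
  assumes "convex_polytope A" "convex_polytope B" "convex_polytope M" "A + M = B + M"
  shows "A = B"
proof (rule equalityI)
  show "A \<subseteq> B"
    using assms(4) compact_imp_closed[OF convex_polytope_imp(2)[OF assms(2)]]
      convex_polytope_imp[OF assms(2)] convex_polytope_imp[OF assms(3)]
    by (intro set_plus_le_cancel[of A M B]) auto
  show "B \<subseteq> A"
    using assms(4) compact_imp_closed[OF convex_polytope_imp(2)[OF assms(1)]]
      convex_polytope_imp[OF assms(1)] convex_polytope_imp[OF assms(3)]
    by (intro set_plus_le_cancel[of B M A]) auto
qed

lemma of_polytope_plus:
  assumes "convex_polytope K" "convex_polytope L"
  shows "of_polytope (K + L) = of_polytope K + of_polytope L"
  using assms
  by transfer (auto simp: virtual_polytope_rel_def convex_polytope_plus simp del: set_zero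
      intro!: exI[of _ 0])

lemma of_polytope_zero: "of_polytope 0 = 0"
  by transfer (auto simp: virtual_polytope_rel_def simp del: set_zero intro!: exI[of _ 0])

lemma of_polytope_eqD:
  assumes "of_polytope K = of_polytope L" "convex_polytope K" "convex_polytope L"
  shows "K = L"
proof -
  have "virtual_polytope_rel (K, 0) (L, 0)"
    using assms by transfer (simp del: set_zero)
  then obtain M where "convex_polytope M" "K + M = L + M"
    by (auto simp: virtual_polytope_rel_def)
  then show ?thesis by (intro convex_polytope_cancel[OF assms(2,3)])
qed

lemma of_polytope_sum:
  assumes "\<And>i. i \<in> I \<Longrightarrow> convex_polytope (K i)"
  shows "of_polytope (\<Sum>i\<in>I. K i) = (\<Sum>i\<in>I. of_polytope (K i))"
  using assms
  by (induction I rule: infinite_finite_induct)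
    (auto simp: of_polytope_zero of_polytope_plus convex_polytope_sum simp del: set_zero)

lemma convex_polytope_scaleR:
  assumes "convex_polytope K" shows "convex_polytope ((*\<^sub>R) a ` K)"
  using assms by (auto simp: convex_polytope_def intro!: polytope_linear_image)

text \<open>
  For \<open>a < 0\<close> this is \<open>b K = (a + b) K + \<bar>a\<bar> K\<close>, read in the group of virtual polytopes.
\<close>

lemma multiple_add:
  assumes K: "convex_polytope K" and b: "0 \<le> b" "0 \<le> a + b"
  shows "multiple (a + b) K = multiple a K + multiple b K"
proof (cases "0 \<le> a")
  case True
  then show ?thesis
    using b K by (simp add: multiple_def scaleR_add_convex convex_polytope_imp
        of_polytope_plus convex_polytope_scaleR)
next
  case False
  have "of_polytope ((*\<^sub>R) b ` K) = of_polytope ((*\<^sub>R) (a + b) ` K) + of_polytope ((*\<^sub>R) (- a) ` K)"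
  proof -
    have "(*\<^sub>R) b ` K = (*\<^sub>R) (a + b) ` K + (*\<^sub>R) (- a) ` K"
      using scaleR_add_convex[of K "a + b" "- a"] b False K by (simp add: convex_polytope_imp)
    then show ?thesis by (simp only: of_polytope_plus convex_polytope_scaleR[OF K])
  qed
  then show ?thesis using b False by (simp add: multiple_def)
qed

lemma convex_polytope_q [simp]: "convex_polytope (q i j)"
  by (simp add: q_def)

lemma convex_polytope_r [simp]: "convex_polytope (r k)"
  by (simp add: r_def)

lemma convex_polytope_zonotope [simp]: "convex_polytope (zonotope c)"
  unfolding zonotope_def
  by (auto intro!: convex_polytope_plus convex_polytope_sum convex_polytope_scaleR)

lemma virtual_zonotope_nonneg:
  assumes "nonneg_coeffs c"
  shows "virtual_zonotope c = of_polytope (zonotope c)"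
proof -
  have "virtual_zonotope c =
      (\<Sum>(i, j)\<in>{(i, j). i < j}. of_polytope ((*\<^sub>R) (fst c $ i $ j) ` q i j)) +
      (\<Sum>k\<in>UNIV. of_polytope ((*\<^sub>R) (snd c $ k) ` r k))"
    unfolding virtual_zonotope_def using assms
    by (intro arg_cong2[of _ _ _ _ "(+)"] sum.cong) (auto simp: nonneg_coeffs_def multiple_def)
  also have "\<dots> = of_polytope (zonotope c)"
    unfolding zonotope_def
    by (subst of_polytope_plus)
      (auto intro!: convex_polytope_sum convex_polytope_scaleR
        simp: of_polytope_sum convex_polytope_scaleR case_prod_beta)
  finally show ?thesis .
qed

lemma virtual_zonotope_add:
  assumes "nonneg_coeffs d" "nonneg_coeffs (c + d)"
  shows "virtual_zonotope (c + d) = virtual_zonotope c + virtual_zonotope d"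
proof -
  have "(\<Sum>(i, j)\<in>{(i, j). i < j}. multiple (fst (c + d) $ i $ j) (q i j)) =
      (\<Sum>(i, j)\<in>{(i, j). i < j}. multiple (fst c $ i $ j) (q i j) + multiple (fst d $ i $ j) (q i j))"
    using assms by (intro sum.cong) (auto simp: nonneg_coeffs_def intro!: multiple_add)
  moreover have "(\<Sum>k\<in>UNIV. multiple (snd (c + d) $ k) (r k)) =
      (\<Sum>k\<in>UNIV. multiple (snd c $ k) (r k) + multiple (snd d $ k) (r k))"
    using assms by (intro sum.cong) (auto simp: nonneg_coeffs_def intro!: multiple_add)
  ultimately show ?thesis
    unfolding virtual_zonotope_def by (simp add: sum.distrib case_prod_beta algebra_simps)
qed

section \<open>Polynomial functions\<close>

lemma real_polynomial_function_eqI: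
  assumes f: "real_polynomial_function f" and g: "real_polynomial_function (g :: real \<Rightarrow> real)"
    and eq: "\<And>s. a \<le> s \<Longrightarrow> f s = g s"
  shows "f s = g s"
proof -
  obtain b n where b: "(\<lambda>x. f x - g x) = (\<lambda>x. \<Sum>i\<le>n. b i * x ^ i)"
    using real_polynomial_function_imp_sum[OF real_polynomial_function_diff[OF f g]] by blast
  have "{a..} \<subseteq> {x. (\<Sum>i\<le>n. b i * x ^ i) = 0}"
    using eq by (auto simp flip: b[THEN fun_cong])
  then have "infinite {x. (\<Sum>i\<le>n. b i * x ^ i) = 0}"
    using infinite_Ici finite_subset by blast
  then have "\<forall>i\<le>n. b i = 0" using polyfun_roots_finite by blast
  then have "(\<lambda>x. f x - g x) = (\<lambda>_. 0)" unfolding b by (simp add: fun_eq_iff)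
  then show ?thesis by (metis eq_iff_diff_eq_0)
qed

lemma real_polynomial_function_ray_eq:
  fixes P Q :: "'a::real_normed_vector \<Rightarrow> real"
  assumes P: "real_polynomial_function P" and Q: "real_polynomial_function Q"
    and eq: "\<And>s. a \<le> s \<Longrightarrow> P (c + s *\<^sub>R d) = Q (c' + s *\<^sub>R d)"
  shows "P c = Q c'"
proof -
  have line: "polynomial_function (\<lambda>s::real. c + s *\<^sub>R d)" for c d :: 'a
    by (intro polynomial_function_add polynomial_function_const
        polynomial_function_bounded_linear bounded_linear_intros)
  have "(P \<circ> (\<lambda>s. c + s *\<^sub>R d)) 0 = (Q \<circ> (\<lambda>s. c' + s *\<^sub>R d)) 0"
    by (rule real_polynomial_function_eqI[where a = a, OF real_polynomial_function_compose[OF line P]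
          real_polynomial_function_compose[OF line Q]]) (simp add: eq)
  then show ?thesis by simp
qed

lemma real_polynomial_function_det:
  fixes M :: "'a::real_normed_vector \<Rightarrow> real^'n^'n"
  assumes "\<And>i j. real_polynomial_function (\<lambda>x. M x $ i $ j)"
  shows "real_polynomial_function (\<lambda>x. det (M x))"
  unfolding det_def using assms
  by (intro real_polynomial_function_sum real_polynomial_function.intros(4)
      real_polynomial_function.intros(2) real_polynomial_function_prod) (auto simp: finite_permutations)

section \<open>The volume polynomial\<close>

definition generator :: "('n \<times> 'n) + 'n \<Rightarrow> real^'n::{finite,wellorder}" where
  "generator x = (case x of Inl (i, j) \<Rightarrow> axis i 1 - axis j 1 | Inr k \<Rightarrow> R k)"

text \<open>
  Each generator is \<open>stretch\<close> times its graphic part, up to a multiple of the all-ones vector.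
\<close>

definition graphic_part :: "('n \<times> 'n) + 'n \<Rightarrow> real^'n" where
  "graphic_part x = (case x of Inl (i, j) \<Rightarrow> axis i 1 - axis j 1 | Inr k \<Rightarrow> axis k 1)"

definition stretch :: "('n \<times> 'n) + 'n \<Rightarrow> real" where
  "stretch x = (case x of Inl _ \<Rightarrow> 1 | Inr _ \<Rightarrow> CARD('n))"

text \<open>
  The coefficients as a function on the same index type as the generators; pairs that do not satisfy
  \<open>i < j\<close> receive the coefficient \<open>0\<close>.
\<close>

definition coeff_at :: "'n::{finite,wellorder} coeffs \<Rightarrow> ('n \<times> 'n) + 'n \<Rightarrow> real" where
  "coeff_at c x = (case x of Inl (i, j) \<Rightarrow> if i < j then fst c $ i $ j else 0 | Inr k \<Rightarrow> snd c $ k)"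

lemma R_eq: "R k = real CARD('n) *s axis k 1 - 1"
  for k :: "'n::{finite,wellorder}"
proof -
  have "R k $ i = real CARD('n) * axis k 1 $ i - 1" for i
    by (simp add: R_def sum_subtractf axis_def of_nat_index)
  then show ?thesis by (simp add: vec_eq_iff)
qed

lemma generator_eq:
  "generator x = stretch x *s graphic_part x - (case x of Inl _ \<Rightarrow> 0 | Inr _ \<Rightarrow> 1) *s 1"
  by (auto simp: generator_def stretch_def graphic_part_def R_eq split: sum.split)

lemma generator_inner_1: "generator x \<bullet> 1 = 0"
  by (auto simp: generator_eq stretch_def graphic_part_def inner_diff_left inner_axis'
      scalar_mult_eq_scaleR inner_vec_def[of 1 1] split: sum.split)

definition zonotope_matrix :: "'n::{finite,wellorder} coeffs \<Rightarrow> ((real, 'n) vec, 'n) vec" where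
  "zonotope_matrix c = weighted_laplacian graphic_part (\<lambda>x. coeff_at c x * stretch x)"

text \<open>
  The closed form of \<^const>\<open>volume_polynomial\<close>. The factor \<open>1 / sqrt n\<close> scales the all-ones
  vector, by which the zonotope is thickened, to unit length.
\<close>

definition volume_formula :: "'n::{finite,wellorder} coeffs \<Rightarrow> real" where
  "volume_formula c = (\<Sum>v\<in>UNIV.
     det (zonotope_matrix c + (1 / sqrt CARD('n)) *\<^sub>R outer (axis v 1)) - det (zonotope_matrix c))"

lemma sum_singletons: "(\<Sum>i\<in>I. {f i}) = {\<Sum>i\<in>I. f i}"
  by (induction I rule: infinite_finite_induct) (auto simp: set_plus_def)

lemma scaled_q: "(*\<^sub>R) a ` q i j = {a *\<^sub>R axis j 1} + closed_segment 0 (a *\<^sub>R (axis i 1 - axis j 1))"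
proof -
  have "(*\<^sub>R) a ` q i j = closed_segment (a *\<^sub>R axis i 1) (a *\<^sub>R axis j 1)"
    unfolding q_def by (rule closed_segment_linear_image[symmetric]) (rule linear_scaleR)
  also have "\<dots> = closed_segment (a *\<^sub>R axis j 1 + 0)
      (a *\<^sub>R axis j 1 + a *\<^sub>R (axis i 1 - axis j 1))"
    by (simp add: closed_segment_commute algebra_simps)
  also have "\<dots> = (+) (a *\<^sub>R axis j 1) ` closed_segment 0 (a *\<^sub>R (axis i 1 - axis j 1))"
    by (rule closed_segment_translation)
  finally show ?thesis by (auto simp: set_plus_def)
qed

lemma scaled_r: "(*\<^sub>R) a ` r k = closed_segment 0 (a *\<^sub>R R k)"
  unfolding r_def using closed_segment_linear_image[OF linear_scaleR, of a 0 "R k"] by simp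

lemma zonotope_translate:
  "zonotope c = {\<Sum>(i, j)\<in>{(i, j). i < j}. (fst c $ i $ j) *\<^sub>R axis j 1} +
     zonotope_of (\<lambda>x. coeff_at c x *\<^sub>R generator x)"
proof -
  have "zonotope_of (\<lambda>x. coeff_at c x *\<^sub>R generator x) =
      (\<Sum>x\<in>UNIV. closed_segment 0 (coeff_at c (Inl x) *\<^sub>R generator (Inl x))) +
      (\<Sum>k\<in>UNIV. closed_segment 0 (coeff_at c (Inr k) *\<^sub>R generator (Inr k)))"
    unfolding zonotope_of_def UNIV_Plus_UNIV[symmetric] by (subst sum.Plus) (auto simp: comp_def)
  also have "(\<Sum>x\<in>UNIV. closed_segment 0 (coeff_at c (Inl x) *\<^sub>R generator (Inl x))) =
      (\<Sum>(i, j)\<in>{(i, j). i < j}. closed_segment 0 ((fst c $ i $ j) *\<^sub>R (axis i 1 - axis j 1)))"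
    by (rule sum.mono_neutral_cong_right) (auto simp: coeff_at_def generator_def split: prod.splits)
  finally show ?thesis
    by (simp add: zonotope_def scaled_q scaled_r sum.distrib case_prod_beta sum_singletons
        coeff_at_def generator_def add.assoc)
qed

lemma zonotope_of_option:
  "zonotope_of f = closed_segment 0 (f None) + zonotope_of (\<lambda>x. f (Some x))"
  unfolding zonotope_of_def UNIV_option_conv by (simp add: sum.reindex)

lemma zonotope_flat:
  fixes c :: "'n::{finite,wellorder} coeffs"
  assumes "x \<in> zonotope c" "y \<in> zonotope c"
  shows "x - y \<in> sum_zero_hyperplane"
proof -
  have hyp: "z \<in> sum_zero_hyperplane \<longleftrightarrow> z \<bullet> 1 = 0" for z :: "real^'n::_"
    by (simp add: sum_zero_hyperplane_def inner_vec_def)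
  have "z \<bullet> 1 = 0" if "z \<in> zonotope_of (\<lambda>x. coeff_at c x *\<^sub>R generator x)" for z
    using that by (auto simp: zonotope_of_eq inner_sum_left generator_inner_1)
  then show ?thesis
    using assms unfolding zonotope_translate hyp
    by (auto simp: set_plus_def inner_diff_left inner_add_left)
qed

text \<open>
  The unit normal segment is \<open>1 / sqrt n\<close> times the all-ones segment, so that the thickened zonotope is
  generated by the \<open>R k\<close>, the differences \<open>e\<^sub>i - e\<^sub>j\<close> and the all-ones vector.
\<close>

lemma volume_along_zonotope:
  fixes c :: "'n::{finite,wellorder} coeffs"
  assumes c: "nonneg_coeffs c"
  shows "volume_along sum_zero_hyperplane (zonotope c + {t}) = volume_formula c"
proof -
  define c' where "c' k = (case k of None \<Rightarrow> 1 / sqrt CARD('n) | Some x \<Rightarrow> coeff_at c x)" for k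
  have c': "0 \<le> c' k" for k
    using c by (auto simp: c'_def coeff_at_def nonneg_coeffs_def split: option.split sum.split)
  have "volume_along sum_zero_hyperplane (zonotope c + {t}) =
      measure lebesgue (zonotope c + {t} + closed_segment 0 unit_normal)"
    by (intro volume_along_sum_zero_hyperplane convex_polytope_plus)
      (auto simp: set_plus_def zonotope_flat)
  also have "zonotope c + {t} + closed_segment 0 unit_normal =
      {t + (\<Sum>(i, j)\<in>{(i, j). i < j}. (fst c $ i $ j) *\<^sub>R axis j 1)} +
      zonotope_of (\<lambda>k. c' k *\<^sub>R with_ones generator k)"
  proof -
    have singletons: "{t + x} = {t} + {x}" for x by (simp add: set_plus_def)
    show ?thesis
      unfolding zonotope_of_option[of "\<lambda>k. c' k *\<^sub>R with_ones generator k"] zonotope_translate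
        singletons
      by (simp add: c'_def with_ones_def unit_normal_def ac_simps)
  qed
  also have "\<dots> = (+) (t + (\<Sum>(i, j)\<in>{(i, j). i < j}. (fst c $ i $ j) *\<^sub>R axis j 1)) `
      zonotope_of (\<lambda>k. c' k *\<^sub>R with_ones generator k)"
    by (auto simp: set_plus_def)
  also have "measure lebesgue \<dots> = measure lebesgue (zonotope_of (\<lambda>k. c' k *\<^sub>R with_ones generator k))"
    by (rule measure_translation)
  also have "\<dots> = volume_formula c"
    unfolding volume_formula_def zonotope_matrix_def
    by (subst volume_eq_sum_minors[where z = graphic_part and \<delta> = stretch, OF _ _ generator_eq])
      (use c' in \<open>auto simp: c'_def graphic_def graphic_part_def stretch_def generator_inner_1
        split: sum.split\<close>)
  finally show ?thesis .
qed

lemma real_polynomial_function_volume_formula: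
  "real_polynomial_function (volume_formula :: 'n::{finite,wellorder} coeffs \<Rightarrow> real)"
proof -
  have coeff: "real_polynomial_function (\<lambda>c. coeff_at c x)" for x :: "('n \<times> 'n) + 'n"
  proof (cases x)
    case (Inl p)
    obtain i j where p: "p = (i, j)" by (cases p)
    show ?thesis
      by (cases "i < j") (auto simp: coeff_at_def Inl p intro!: real_polynomial_function.intros
          bounded_linear_compose[OF bounded_linear_vec_nth] bounded_linear_fst)
  qed (auto simp: coeff_at_def intro!: real_polynomial_function.intros
      bounded_linear_compose[OF bounded_linear_vec_nth] bounded_linear_snd)
  have "real_polynomial_function (\<lambda>c. zonotope_matrix c $ i $ j)" for i j :: 'n
  proof -
    have "zonotope_matrix c $ i $ j =
        (\<Sum>x\<in>UNIV. coeff_at c x * (stretch x * outer (graphic_part x) $ i $ j))" for c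
      by (simp add: zonotope_matrix_def weighted_laplacian_def mult.assoc)
    then show ?thesis
      by (simp only:) (intro real_polynomial_function_sum coeff real_polynomial_function.intros(2,4); simp)
  qed
  note entry = this
  have "real_polynomial_function (\<lambda>c. (zonotope_matrix c + M) $ i $ j)"
    for i j and M :: "((real, 'n) vec, 'n) vec"
    unfolding vector_add_component by (intro real_polynomial_function.intros(2,3) entry)
  note shifted = this
  show ?thesis
    unfolding volume_formula_def[abs_def]
    by (intro real_polynomial_function_sum real_polynomial_function_diff
        real_polynomial_function_det entry shifted) simp_all
qed

section \<open>The volume of a virtual zonotope\<close>

definition all_ones :: "'n::{finite,wellorder} coeffs" where
  "all_ones = (\<chi> i j. 1, \<chi> k. 1)"

lemma eventually_nonneg_coeffs:
  fixes c :: "'n::{finite,wellorder} coeffs"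
  obtains a where "0 \<le> a" "\<And>s. a \<le> s \<Longrightarrow> nonneg_coeffs (c + s *\<^sub>R all_ones)"
proof
  let ?a = "norm c"
  have *: "- norm c \<le> fst c $ i $ j" "- norm c \<le> snd c $ k" for i j k
  proof -
    have "\<bar>fst c $ i $ j\<bar> \<le> norm (fst c)"
      using component_le_norm_cart[of "fst c $ i" j]
        Finite_Cartesian_Product.norm_nth_le[of "fst c" i] by linarith
    then show "- norm c \<le> fst c $ i $ j" using norm_fst_le[of "fst c" "snd c"] by simp
    have "\<bar>snd c $ k\<bar> \<le> norm (snd c)" by (rule component_le_norm_cart)
    then show "- norm c \<le> snd c $ k" using norm_snd_le[of "snd c" "fst c"] by simp
  qed
  show "0 \<le> ?a" by simp
  show "nonneg_coeffs (c + s *\<^sub>R all_ones)" if "?a \<le> s" for s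
    unfolding nonneg_coeffs_def
  proof (intro conjI allI impI)
    show "0 \<le> fst (c + s *\<^sub>R all_ones) $ i $ j" for i j
      using *(1)[of i j] that by (simp add: all_ones_def)
    show "0 \<le> snd (c + s *\<^sub>R all_ones) $ k" for k
      using *(2)[of k] that by (simp add: all_ones_def)
  qed
qed

lemma nonneg_all_ones: "0 \<le> s \<Longrightarrow> nonneg_coeffs (s *\<^sub>R all_ones)"
  by (simp add: nonneg_coeffs_def all_ones_def)

lemma volume_polynomial_eq:
  "(volume_polynomial :: 'n::{finite,wellorder} coeffs \<Rightarrow> real) = volume_formula"
  unfolding volume_polynomial_def
proof (rule the_equality)
  have vol: "volume_along sum_zero_hyperplane (zonotope c) = volume_formula c" if "nonneg_coeffs c"
    for c :: "'n coeffs"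
    using volume_along_zonotope[OF that, of 0] by (simp flip: set_zero)
  show "real_polynomial_function (volume_formula :: 'n coeffs \<Rightarrow> real) \<and>
      (\<forall>c :: 'n coeffs. nonneg_coeffs c \<longrightarrow> volume_formula c = volume_along sum_zero_hyperplane (zonotope c))"
    by (intro conjI allI impI real_polynomial_function_volume_formula) (simp only: vol)
  fix P :: "'n coeffs \<Rightarrow> real"
  assume P: "real_polynomial_function P \<and>
      (\<forall>c. nonneg_coeffs c \<longrightarrow> P c = volume_along sum_zero_hyperplane (zonotope c))"
  show "P = volume_formula"
  proof
    fix c :: "'n coeffs"
    obtain a where a: "\<And>s. a \<le> s \<Longrightarrow> nonneg_coeffs (c + s *\<^sub>R all_ones)"
      using eventually_nonneg_coeffs[of c] by blast
    show "P c = volume_formula c"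
    proof (rule real_polynomial_function_ray_eq[where a = a and d = all_ones])
      show "P (c + s *\<^sub>R all_ones) = volume_formula (c + s *\<^sub>R all_ones)" if "a \<le> s" for s
        using P vol[OF a[OF that]] a[OF that] by metis
    qed (use P real_polynomial_function_volume_formula in \<open>blast+\<close>)
  qed
qed

text \<open>
  The zonotope with all coefficients equal to \<open>s\<close> is added to both sides: for large \<open>s\<close> the two virtual
  polytopes become convex ones that are translates of each other, and so have equal volume.
\<close>

lemma volume_formula_cong:
  assumes eq: "virtual_zonotope c + of_polytope {t} = virtual_zonotope c' + of_polytope {t'}"
  shows "volume_formula c = volume_formula c'"
proof -
  obtain a where a: "0 \<le> a" "\<And>s. a \<le> s \<Longrightarrow> nonneg_coeffs (c + s *\<^sub>R all_ones)"
    using eventually_nonneg_coeffs[of c] by blast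
  obtain a' where a': "0 \<le> a'" "\<And>s. a' \<le> s \<Longrightarrow> nonneg_coeffs (c' + s *\<^sub>R all_ones)"
    using eventually_nonneg_coeffs[of c'] by blast
  show ?thesis
  proof (rule real_polynomial_function_ray_eq[where a = "max a a'" and d = all_ones])
    fix s assume "max a a' \<le> s"
    then have s: "nonneg_coeffs (c + s *\<^sub>R all_ones)" "nonneg_coeffs (c' + s *\<^sub>R all_ones)" "0 \<le> s"
      using a a' by auto
    have shift: "of_polytope (zonotope (b + s *\<^sub>R all_ones) + {x}) =
        virtual_zonotope b + of_polytope {x} + virtual_zonotope (s *\<^sub>R all_ones)"
      if "nonneg_coeffs (b + s *\<^sub>R all_ones)" for b x
      using virtual_zonotope_add[OF nonneg_all_ones[OF s(3)] that]
      by (simp add: of_polytope_plus virtual_zonotope_nonneg[OF that, symmetric] ac_simps)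
    have "zonotope (c + s *\<^sub>R all_ones) + {t} = zonotope (c' + s *\<^sub>R all_ones) + {t'}"
      by (rule of_polytope_eqD) (simp_all add: shift s eq convex_polytope_plus)
    then show "volume_formula (c + s *\<^sub>R all_ones) = volume_formula (c' + s *\<^sub>R all_ones)"
      using volume_along_zonotope[OF s(1), of t] volume_along_zonotope[OF s(2), of t'] by simp
  qed (rule real_polynomial_function_volume_formula)+
qed

lemma virtual_volume_eq:
  fixes c :: "'n::{finite,wellorder} coeffs"
  shows "virtual_volume (virtual_zonotope c + of_polytope {t}) = volume_formula c"
  unfolding virtual_volume_def volume_polynomial_eq
proof (rule the_equality)
  show "\<exists>c' t'. virtual_zonotope c + of_polytope {t} = virtual_zonotope c' + of_polytope {t'} \<and>
    volume_formula c = volume_formula c'"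
    by (rule exI[of _ c], rule exI[of _ t]) (intro conjI refl)
  fix v
  assume "\<exists>c' t'. virtual_zonotope c + of_polytope {t} = virtual_zonotope c' + of_polytope {t'} \<and>
    v = volume_formula c'"
  then obtain c' t' where eq: "virtual_zonotope c + of_polytope {t} = virtual_zonotope c' + of_polytope {t'}"
    and v: "v = volume_formula c'" by (elim exE conjE)
  show "v = volume_formula c" unfolding v by (rule volume_formula_cong[OF eq, symmetric])
qed

section \<open>The cyclopermutohedron\<close>

lemma cyclopermutohedron_eq:
  "(cyclopermutohedron :: (real^'n::{finite,wellorder}) virtual_polytope) =
    virtual_zonotope (\<chi> i j. 1, \<chi> k. - 1) + of_polytope {\<Sum>i\<in>UNIV. axis i 1}"
proof -
  have "multiple 1 K = of_polytope K" "multiple (- 1) K = - of_polytope K"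
    for K :: "(real^'n::_) set"
    by (simp_all add: multiple_def)
  then show ?thesis
    unfolding cyclopermutohedron_def virtual_zonotope_def
    by (simp add: sum_negf algebra_simps)
qed

lemma sum_less_symmetric:
  fixes f :: "'n::{finite,linorder} \<Rightarrow> 'n \<Rightarrow> real"
  assumes "\<And>i j. f i j = f j i" "\<And>i. f i i = 0"
  shows "2 * (\<Sum>i\<in>UNIV. \<Sum>j\<in>UNIV. if i < j then f i j else 0) = (\<Sum>i\<in>UNIV. \<Sum>j\<in>UNIV. f i j)"
proof -
  let ?g = "\<lambda>i j. if i < j then f i j else 0"
  have "(\<Sum>i\<in>UNIV. \<Sum>j\<in>UNIV. f i j) = (\<Sum>i\<in>UNIV. \<Sum>j\<in>UNIV. ?g i j + ?g j i)"
    using assms by (intro sum.cong refl) (metis add_0 add_0_right less_asym linorder_less_linear)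
  also have "\<dots> = (\<Sum>i\<in>UNIV. \<Sum>j\<in>UNIV. ?g i j) + (\<Sum>i\<in>UNIV. \<Sum>j\<in>UNIV. ?g j i)"
    by (simp add: sum.distrib)
  also have "(\<Sum>i\<in>UNIV. \<Sum>j\<in>UNIV. ?g j i) = (\<Sum>i\<in>UNIV. \<Sum>j\<in>UNIV. ?g i j)"
    by (rule sum.swap)
  finally show ?thesis by simp
qed

text \<open>
  The Laplacian of the complete graph is \<open>n I - J\<close>; the generators \<open>r k\<close> contribute \<open>- n I\<close>.
\<close>

lemma zonotope_matrix_cyclopermutohedron:
  "zonotope_matrix ((\<chi> i j. 1, \<chi> k. - 1) :: 'n::{finite,wellorder} coeffs) = (\<chi> i j. - 1)"
proof -
  have "zonotope_matrix ((\<chi> i j. 1, \<chi> k. - 1) :: 'n coeffs) $ a $ b = - 1" for a b :: 'n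
  proof -
    define f where "f i j = outer (axis i 1 - axis j 1 :: real^'n::_) $ a $ b" for i j
    \<comment> \<open>symmetric in \<open>i\<close> and \<open>j\<close> and zero for \<open>i = j\<close>, so that the sum over \<open>i < j\<close> is half of a double sum\<close>
    have f: "f i j = (of_bool (a = i) - of_bool (a = j)) * (of_bool (b = i) - of_bool (b = j))" for i j
      by (simp add: f_def outer_def axis_def of_bool_def)
    have "zonotope_matrix ((\<chi> i j. 1, \<chi> k. - 1) :: 'n coeffs) $ a $ b =
      (\<Sum>(i, j)\<in>UNIV. if i < j then f i j else 0) -
      (\<Sum>k\<in>UNIV. real CARD('n) * outer (axis k 1 :: real^'n::_) $ a $ b)"
      unfolding zonotope_matrix_def weighted_laplacian_def UNIV_Plus_UNIV[symmetric]
      by (subst sum.Plus)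
        (auto simp: coeff_at_def stretch_def graphic_part_def f_def sum_negf comp_def
          intro!: sum.cong split: prod.splits)
    also have "(\<Sum>(i, j)\<in>UNIV. if i < j then f i j else 0) =
        (\<Sum>i\<in>UNIV. \<Sum>j\<in>UNIV. if i < j then f i j else 0)"
      by (simp add: sum.cartesian_product UNIV_Times_UNIV)
    also have "\<dots> = (\<Sum>i\<in>UNIV. \<Sum>j\<in>UNIV. f i j) / 2"
      using sum_less_symmetric[of f] by (simp add: f algebra_simps)
    also have "(\<Sum>i\<in>UNIV. \<Sum>j\<in>UNIV. f i j) = 2 * real CARD('n) * of_bool (a = b) - 2"
      by (simp add: f left_diff_distrib right_diff_distrib sum_subtractf sum.distrib
          flip: sum_distrib_left sum_distrib_right)
    also have "(\<Sum>k\<in>UNIV. real CARD('n) * outer (axis k 1 :: real^'n::_) $ a $ b) =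
        real CARD('n) * of_bool (a = b)"
    proof -
      have "real CARD('n) * outer (axis k 1 :: real^'n::_) $ a $ b =
          (if k = a then real CARD('n) * of_bool (a = b) else 0)" for k
        by (auto simp: outer_def axis_def)
      then show ?thesis by simp
    qed
    finally show ?thesis by (simp add: field_simps)
  qed
  then show ?thesis by (simp add: vec_eq_iff)
qed

text \<open>
  All rows of \<open>- J + s E\<^sub>v\<^sub>v\<close> except row \<open>v\<close> are equal, and for \<open>n \<ge> 3\<close> there are at least two of them.
\<close>

lemma volume_formula_cyclopermutohedron:
  assumes "CARD('n::{finite,wellorder}) \<ge> 3"
  shows "volume_formula ((\<chi> i j. 1, \<chi> k. - 1) :: 'n coeffs) = 0"
proof -
  have singular: "det ((\<chi> i j. - 1) + s *\<^sub>R outer (axis v 1) :: ((real, 'n) vec, 'n) vec) = 0"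
    for s :: real and v :: 'n
  proof -
    have "2 \<le> card (UNIV - {v})" using assms by simp
    then obtain T where T: "T \<subseteq> UNIV - {v}" "card T = 2"
      by (meson obtain_subset_with_card_n)
    then obtain a b where "T = {a, b}" "a \<noteq> b" by (auto simp: card_2_iff)
    with T have "a \<noteq> b" "a \<noteq> v" "b \<noteq> v" by auto
    then show ?thesis
      by (intro det_identical_rows[of a b]) (auto simp: row_def outer_def axis_def vec_eq_iff)
  qed
  from singular[where s = "1 / sqrt CARD('n)"] singular[where s = 0] show ?thesis
    by (simp add: volume_formula_def zonotope_matrix_cyclopermutohedron)
qed

theorem theorem1:
  assumes "CARD('n::{finite,wellorder}) \<ge> 3"
  shows "virtual_volume (cyclopermutohedron :: (real^'n::_) virtual_polytope) = 0"
  unfolding cyclopermutohedron_eq virtual_volume_eq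
  using assms by (rule volume_formula_cyclopermutohedron)

end
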